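(* Assume the standing assumptions. Let $\pi$ be the distribution of $M=\sup_{n\ge0}S_n$. Suppose that for some $g\in\mathcal G^*$ $$\lim_{x\to\infty}\frac{1}{\overline F(x)}\int_{(x,\infty)}g(y-x)\,\pi(dy)=\frac1m\int_0^\infty g(t)\,dt.$$ Then $F\in\mathcal S^*$.
   Context: Standing assumptions: $\{\xi_n\}_{n\ge1}$ are i.i.d. real random variables with common distribution function $F$ and finite mean $\mathbf E\xi_1=-m<0$. $F$ is long-tailed: $\overline F(x)=1-F(x)>0$ for all $x$, and $\overline F(x-c)/\overline F(x)\to1$ as $x\to\infty$ for every fixed $c>0$. Notation: $S_0=0$ and $S_n=\sum_{i=1}^n\xi_i$. Function classes: $\mathcal G$ is the class of nonnegative, directly Riemann integrable functions on $\mathbb R_+$. $\mathcal G^*$ is the subclass of those $g\in\mathcal G$ that are bounded away from zero on some interval of positive length. The class $\mathcal S^*$: a distribution function $G$ on $\mathbb R$ belongs to $\mathcal S^*$ iff $\overline G(x)>0$ for all $x$ and $$\int_0^x\overline G(x-y)\overline G(y)\,dy\sim 2m_{G^+}\overline G(x)\quad(x\to\infty),$$ where $m_{G^+}=\int_0^\infty\overline G(t)\,dt$. *)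

theory Defs
  imports "HOL-Probability.Probability"
begin

definition upper_dri_sum :: "(real \<Rightarrow> real) \<Rightarrow> real \<Rightarrow> real" where
  "upper_dri_sum g h = h * (\<Sum>n. Sup (g ` {real n * h .. (real n + 1) * h}))"

definition lower_dri_sum :: "(real \<Rightarrow> real) \<Rightarrow> real \<Rightarrow> real" where
  "lower_dri_sum g h = h * (\<Sum>n. Inf (g ` {real n * h .. (real n + 1) * h}))"

definition directly_riemann_integrable :: "(real \<Rightarrow> real) \<Rightarrow> bool" where
  "directly_riemann_integrable g \<longleftrightarrow>
     (\<forall>h>0. (\<forall>n::nat. bdd_above (g ` {real n * h .. (real n + 1) * h})
                  \<and> bdd_below (g ` {real n * h .. (real n + 1) * h}))
           \<and> summable (\<lambda>n. Sup (g ` {real n * h .. (real n + 1) * h}))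
           \<and> summable (\<lambda>n. Inf (g ` {real n * h .. (real n + 1) * h})))
   \<and> ((\<lambda>h. upper_dri_sum g h - lower_dri_sum g h) \<longlongrightarrow> 0) (at_right 0)"

definition class_G :: "(real \<Rightarrow> real) set" where
  "class_G = {g. (\<forall>t\<ge>0. g t \<ge> 0) \<and> directly_riemann_integrable g}"

definition class_G_star :: "(real \<Rightarrow> real) set" where
  "class_G_star = {g \<in> class_G. \<exists>a b c. 0 \<le> a \<and> a < b \<and> c > 0 \<and> (\<forall>t\<in>{a..b}. g t \<ge> c)}"

definition class_S_star :: "(real \<Rightarrow> real) set" where
  "class_S_star = {G. (\<forall>x. 1 - G x > 0)
      \<and> (\<lambda>t. 1 - G t) integrable_on {0..}
      \<and> (\<lambda>x. integral {0..x} (\<lambda>y. (1 - G (x - y)) * (1 - G y)))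
           \<sim>[at_top] (\<lambda>x. 2 * integral {0..} (\<lambda>t. 1 - G t) * (1 - G x))}"

text \<open>Supremum of the random walk S_0 = 0, S_n = xi_1 + ... + xi_n (indices shifted to start
  at 0), computed in the extended reals and converted back (it is a.s. finite).\<close>
definition walk_sup :: "(nat \<Rightarrow> 'a \<Rightarrow> real) \<Rightarrow> 'a \<Rightarrow> real" where
  "walk_sup X \<omega> = real_of_ereal (SUP n. ereal (\<Sum>i<n. X i \<omega>))"

end

theory Submission
  imports Defs
begin

text \<open>
  Let \<open>T = 1 - F\<close>, let \<open>M\<close> have law \<open>\<pi>\<close>, and let \<open>G x\<close> be the integral of \<open>g (y - x)\<close> over
  \<open>y > x\<close> with respect to \<open>\<pi>\<close>, so that \<open>G x \<sim> (I / m) T x\<close> with \<open>I = \<integral> g\<close>. Since \<open>M\<close> and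
  \<open>(M + \<xi>)\<^sup>+\<close> have the same law, up-crossings of the level \<open>x\<close> balance down-crossings:
  \<open>\<integral> T (x - y) \<pi>(dy)\<close> over \<open>y \<le> x\<close> equals \<open>\<integral> F (x - y) \<pi>(dy)\<close> over \<open>y > x\<close>. Integrating this
  identity, with \<open>x\<close> replaced by \<open>x + t\<close>, against \<open>g t dt\<close> turns both sides into integrals of
  \<open>G\<close>: the right-hand side becomes \<open>\<integral> F (- s) G (x + s) ds \<le> (1 + o(1)) (I / m) (E \<xi>\<^sup>-) T x\<close>,
  while on the left the part \<open>y > A\<close> dominates the integral of \<open>T (x - z) G z\<close> over \<open>A \<le> z \<le> x\<close>
  and the part \<open>y \<le> A\<close> is asymptotically \<open>I \<pi>[0, A] T x\<close>. As \<open>E \<xi>\<^sup>- = m + E \<xi>\<^sup>+\<close>, letting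
  \<open>A\<close> grow bounds the convolution integral over \<open>[A, x]\<close> by \<open>(E \<xi>\<^sup>+ + o(1)) T x\<close>, which is the
  nontrivial half of \<open>S*\<close>. No renewal theorem and no lattice distinction are involved.
\<close>

section \<open>Supremum of the random walk\<close>

text \<open>Kept in \<open>ereal\<close> and as a function of a single path: divergence stays
  visible here, whereas \<open>real_of_ereal\<close> in \<open>walk_sup\<close> sends \<infinity> to
  0.\<close>

definition walk_esup :: "(nat \<Rightarrow> real) \<Rightarrow> ereal" where
  "walk_esup x = (SUP n. ereal (\<Sum>i<n. x i))"

lemma walk_sup_eq_esup: "walk_sup X \<omega> = real_of_ereal (walk_esup (\<lambda>i. X i \<omega>))"
  by (simp add: walk_sup_def walk_esup_def)

lemma walk_esup_nonneg: "0 \<le> walk_esup x"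
  unfolding walk_esup_def by (rule SUP_upper2[of 0]) auto

text \<open>The Lindley recursion. Index 0 contributes the empty sum; every later partial sum
  contains \<open>s\<close>, which comes out of the supremum.\<close>

lemma walk_esup_case_nat: "walk_esup (case_nat s x) = max 0 (ereal s + walk_esup x)"
proof -
  have U: "(UNIV :: nat set) = insert 0 (range Suc)"
    by (rule UNIV_nat_eq)
  have "walk_esup (case_nat s x) = sup 0 (SUP n. ereal (\<Sum>i<Suc n. case_nat s x i))"
    unfolding walk_esup_def by (subst U) (simp add: image_image zero_ereal_def)
  also have "(\<lambda>n. ereal (\<Sum>i<Suc n. case_nat s x i)) = (\<lambda>n. ereal s + ereal (\<Sum>i<n. x i))"
    by (auto simp: sum.lessThan_Suc_shift fun_eq_iff simp del: sum.lessThan_Suc)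
  also have "(SUP n. ereal s + ereal (\<Sum>i<n. x i)) = ereal s + walk_esup x"
    unfolding walk_esup_def by (rule SUP_ereal_add_right) auto
  finally show ?thesis by (simp add: sup_max)
qed

text \<open>By the recursion, one finite step can neither create nor remove divergence; this is what
  makes divergence a tail event.\<close>

lemma walk_esup_shift_infinite:
  "walk_esup (\<lambda>i. x (i + n)) = \<infinity> \<longleftrightarrow> walk_esup x = \<infinity>"
proof (induction n)
  case (Suc n)
  have "(\<lambda>i. x (i + n)) = case_nat (x n) (\<lambda>i. x (i + Suc n))"
    by (auto simp: fun_eq_iff split: nat.split)
  then have "walk_esup (\<lambda>i. x (i + n)) = max 0 (ereal (x n) + walk_esup (\<lambda>i. x (i + Suc n)))"
    by (metis walk_esup_case_nat)
  then have "walk_esup (\<lambda>i. x (i + n)) = \<infinity> \<longleftrightarrow> walk_esup (\<lambda>i. x (i + Suc n)) = \<infinity>"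
    by (cases "walk_esup (\<lambda>i. x (i + Suc n))") (auto simp: max_def zero_ereal_def)
  with Suc show ?case by simp
qed simp

text \<open>Kolmogorov's zero-one law: divergence is decided by the steps from any index
  \<open>n\<close> on. In the main proof this reduces finiteness of the supremum to excluding almost
  sure divergence.\<close>

lemma (in prob_space) prob_walk_esup_infinite:
  assumes ind: "indep_vars (\<lambda>_. borel) X UNIV"
  shows "prob {\<omega> \<in> space M. walk_esup (\<lambda>i. X i \<omega>) = \<infinity>} \<in> {0, 1}"
proof -
  define A where "A i = sigma_sets (space M) {X i -` B \<inter> space M | B. B \<in> sets borel}" for i
  have "{\<omega> \<in> space M. walk_esup (\<lambda>i. X i \<omega>) = \<infinity>} \<in> tail_events A"
    unfolding tail_events_def
  proof
    fix n
    let ?N = "sigma (space M) (\<Union> (A ` {n..}))"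
    have sub: "\<Union> (A ` {n..}) \<subseteq> Pow (space M)"
      by (auto simp: A_def dest: sigma_sets_into_sp[rotated])
    have [measurable]: "X i \<in> ?N \<rightarrow>\<^sub>M borel" if "n \<le> i" for i
    proof (rule measurableI)
      fix B :: "real set" assume "B \<in> sets borel"
      then have "X i -` B \<inter> space M \<in> \<Union> (A ` {n..})" using that by (auto simp: A_def)
      then show "X i -` B \<inter> space ?N \<in> sets ?N"
        using sub by (auto simp: space_measure_of sets_measure_of)
    qed (auto simp: space_measure_of[OF sub])
    have "{\<omega> \<in> space ?N. walk_esup (\<lambda>i. X (i + n) \<omega>) = \<infinity>} \<in> sets ?N"
      unfolding walk_esup_def by measurable
    then show "{\<omega> \<in> space M. walk_esup (\<lambda>i. X i \<omega>) = \<infinity>} \<in> sigma_sets (space M) (\<Union> (A ` {n..}))"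
      using sub walk_esup_shift_infinite[of "\<lambda>i. X i _" n]
      by (simp add: sets_measure_of)
  qed
  moreover have "indep_sets A UNIV"
    using ind unfolding indep_vars_def A_def by blast
  moreover have "sigma_algebra (space M) (A i)" for i
    unfolding A_def by (rule sigma_algebra_sigma_sets) blast
  ultimately show ?thesis
    using kolmogorov_0_1_law[of A] by blast
qed

section \<open>Stationarity of the supremum and balance of level crossings\<close>

lemma walk_esup_measurable [measurable]:
  "walk_esup \<in> borel_measurable (\<Pi>\<^sub>M i\<in>UNIV. borel)"
  unfolding walk_esup_def[abs_def] by measurable

text \<open>Prepend an independent step \<open>s\<close> to a path with supremum \<open>W\<close>.
  By stationarity, \<open>W\<close> and \<open>max 0 (s + W)\<close> exceed \<open>x\<close> with
  the same probability; removing the event that both do leaves up-crossings and down-crossings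
  equally likely. Integrating out the step for fixed \<open>W\<close> gives the two sides.\<close>

lemma walk_sup_balance:
  fixes N :: "real measure" and x :: real
  assumes "prob_space N" and sets_N: "sets N = sets borel"
    and fin: "AE \<omega> in (\<Pi>\<^sub>M i\<in>UNIV. N). walk_esup \<omega> < \<infinity>"
    and x: "0 \<le> x"
  defines "\<pi> \<equiv> distr (\<Pi>\<^sub>M i\<in>UNIV. N) borel (\<lambda>\<omega>. real_of_ereal (walk_esup \<omega>))"
  shows "(\<integral>\<^sup>+y. indicator {..x} y * emeasure N {x - y<..} \<partial>\<pi>) =
    (\<integral>\<^sup>+y. indicator {x<..} y * emeasure N {..x - y} \<partial>\<pi>)"
proof -
  let ?S = "\<Pi>\<^sub>M i\<in>(UNIV::nat set). N"
  interpret N: prob_space N by fact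
  interpret sequence_space N by unfold_locales
  interpret NS: pair_prob_space N ?S by unfold_locales
  have sigma_finite_S: "sigma_finite_measure ?S" by unfold_locales
  note sets_N[measurable_cong]
  define W where "W \<omega> = real_of_ereal (walk_esup \<omega>)" for \<omega>
  have sS: "sets ?S = sets (\<Pi>\<^sub>M i\<in>UNIV. borel)"
    by (rule sets_PiM_cong) (auto simp: sets_N)
  have [measurable]: "walk_esup \<in> borel_measurable ?S"
    using walk_esup_measurable by (simp cong: measurable_cong_sets add: sS)
  have W[measurable]: "W \<in> borel_measurable ?S"
    unfolding W_def[abs_def] by measurable
  have W0: "0 \<le> W \<omega>" for \<omega>
    unfolding W_def by (simp add: real_of_ereal_pos walk_esup_nonneg)
  have Wcase: "W (case_nat s \<omega>) = max 0 (s + W \<omega>)" if "walk_esup \<omega> < \<infinity>" for s \<omega>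
    using that walk_esup_nonneg[of \<omega>] unfolding W_def walk_esup_case_nat
    by (cases "walk_esup \<omega>") (auto simp: max_def zero_ereal_def)
  let ?P = "N \<Otimes>\<^sub>M ?S"
  have prob_P: "prob_space ?P" by unfold_locales
  have fin': "AE p in ?P. walk_esup (snd p) < \<infinity>"
  proof -
    show ?thesis
    proof (rule NS.AE_pair_measure)
      show "AE s in N. AE \<omega> in ?S. walk_esup (snd (s, \<omega>)) < \<infinity>"
        using fin by simp
    qed measurable
  qed
  \<comment> \<open>\<open>E1\<close> is the up-crossing, \<open>E2\<close> the down-crossing and
    \<open>E3\<close> staying above \<open>x\<close>, so \<open>E2 \<union> E3\<close> means
    exceeding \<open>x\<close> before the step and \<open>E1 \<union> E3\<close> exceeding it
    afterwards.\<close>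
  define E1 where "E1 = {p \<in> space ?P. W (snd p) \<le> x \<and> x < fst p + W (snd p)}"
  define E2 where "E2 = {p \<in> space ?P. x < W (snd p) \<and> fst p + W (snd p) \<le> x}"
  define E3 where "E3 = {p \<in> space ?P. x < W (snd p) \<and> x < fst p + W (snd p)}"
  have [measurable]: "E1 \<in> sets ?P" "E2 \<in> sets ?P" "E3 \<in> sets ?P"
    unfolding E1_def E2_def E3_def by measurable
  have case_nat_meas[measurable]: "(\<lambda>(s, \<omega>). case_nat s \<omega>) \<in> ?P \<rightarrow>\<^sub>M ?S"
    unfolding split_beta' by (rule measurable_case_nat') measurable
  have "emeasure ?P (E2 \<union> E3) = emeasure ?P {p \<in> space ?P. x < W (snd p)}"
    by (rule arg_cong[where f = "emeasure ?P"]) (auto simp: E2_def E3_def)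
  also have "\<dots> = (\<integral>\<^sup>+s. emeasure ?S {\<omega> \<in> space ?S. x < W \<omega>} \<partial>N)"
  proof (subst sigma_finite_measure.emeasure_pair_measure_alt[OF sigma_finite_S])
    show "(\<integral>\<^sup>+s. emeasure ?S (Pair s -` {p \<in> space ?P. x < W (snd p)}) \<partial>N) =
        (\<integral>\<^sup>+s. emeasure ?S {\<omega> \<in> space ?S. x < W \<omega>} \<partial>N)"
      by (intro nn_integral_cong arg_cong[where f = "emeasure ?S"]) (auto simp: space_pair_measure)
  qed measurable
  also have "\<dots> = emeasure ?S {\<omega> \<in> space ?S. x < W \<omega>}"
    by (simp add: N.emeasure_space_1)
  \<comment> \<open>Prepending an independent step preserves the product law
    (\<open>PiM_iter\<close>); this is the stationarity.\<close>
  also have "\<dots> = emeasure (distr ?P ?S (\<lambda>(s, \<omega>). case_nat s \<omega>)) {\<omega> \<in> space ?S. x < W \<omega>}"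
    by (simp only: PiM_iter)
  also have "\<dots> = emeasure ?P {p \<in> space ?P. x < W (case_nat (fst p) (snd p))}"
    by (subst emeasure_distr)
       (auto intro!: arg_cong[where f = "emeasure ?P"] dest: measurable_space[OF case_nat_meas] simp: split_beta')
  also have "\<dots> = emeasure ?P (E1 \<union> E3)"
  proof (rule emeasure_eq_AE)
    have "(\<lambda>p. W (case_nat (fst p) (snd p))) \<in> borel_measurable ?P"
      using measurable_compose[OF case_nat_meas W] by (simp add: split_beta')
    then show "{p \<in> space ?P. x < W (case_nat (fst p) (snd p))} \<in> sets ?P"
      by measurable
    \<comment> \<open>As \<open>0 \<le> x\<close>, the truncation at 0 does not affect exceeding
      \<open>x\<close>. The real-valued recursion \<open>Wcase\<close> presupposes a finite
      supremum, hence equality only almost everywhere.\<close>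
    show "AE p in ?P. (p \<in> {p \<in> space ?P. x < W (case_nat (fst p) (snd p))}) = (p \<in> E1 \<union> E3)"
      using fin' by eventually_elim (use x in \<open>auto simp: Wcase E1_def E3_def\<close>)
  qed measurable
  finally have "emeasure ?P E2 + emeasure ?P E3 = emeasure ?P E1 + emeasure ?P E3"
    by (subst (1 2) plus_emeasure) (auto simp: E1_def E2_def E3_def)
  then have eq: "emeasure ?P E1 = emeasure ?P E2"
    using finite_measure.emeasure_finite[OF prob_space.finite_measure[OF prob_P], of E3]
    by (simp add: add.commute[of _ "emeasure ?P E3"] ennreal_add_left_cancel)
  have [measurable]: "(\<lambda>y. emeasure N {x - y<..}) \<in> borel_measurable borel"
    "(\<lambda>y. emeasure N {..x - y}) \<in> borel_measurable borel"
    by (auto intro!: N.measurable_emeasure simp: sets_eq_imp_space_eq[OF sets_N])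
  have "(\<integral>\<^sup>+y. indicator {..x} y * emeasure N {x - y<..} \<partial>\<pi>)
      = (\<integral>\<^sup>+\<omega>. indicator {..x} (W \<omega>) * emeasure N {x - W \<omega><..} \<partial>?S)"
    unfolding \<pi>_def by (subst nn_integral_distr) (auto simp: W_def)
  also have "\<dots> = emeasure ?P E1"
    by (subst NS.emeasure_pair_measure_alt2)
       (auto intro!: nn_integral_cong arg_cong[where f = "emeasure N"] simp: E1_def space_pair_measure indicator_def sets_eq_imp_space_eq[OF sets_N])
  also note eq
  also have "emeasure ?P E2 = (\<integral>\<^sup>+\<omega>. indicator {x<..} (W \<omega>) * emeasure N {..x - W \<omega>} \<partial>?S)"
    by (subst NS.emeasure_pair_measure_alt2)
       (auto intro!: nn_integral_cong arg_cong[where f = "emeasure N"] simp: E2_def space_pair_measure indicator_def sets_eq_imp_space_eq[OF sets_N])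
  also have "\<dots> = (\<integral>\<^sup>+y. indicator {x<..} y * emeasure N {..x - y} \<partial>\<pi>)"
    unfolding \<pi>_def by (subst nn_integral_distr) (auto simp: W_def)
  finally show ?thesis .
qed

section \<open>Directly Riemann integrable functions\<close>

lemma step_interval_exists:
  fixes h t :: real
  assumes "0 < h" "0 < t"
  obtains n :: nat where "t \<in> {real n * h<..(real n + 1) * h}"
proof
  have "1 \<le> \<lceil>t / h\<rceil>" using assms by (simp add: one_le_ceiling)
  then have "real (nat (\<lceil>t / h\<rceil> - 1)) = of_int \<lceil>t / h\<rceil> - 1" by simp
  moreover have "of_int \<lceil>t / h\<rceil> - 1 < t / h" "t / h \<le> of_int \<lceil>t / h\<rceil>" by linarith+
  moreover from this assms have "t \<le> of_int \<lceil>t / h\<rceil> * h" by (simp only: pos_divide_le_eq)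
  ultimately show "t \<in> {real (nat (\<lceil>t / h\<rceil> - 1)) * h<..(real (nat (\<lceil>t / h\<rceil> - 1)) + 1) * h}"
    using assms by (simp add: pos_divide_le_eq pos_less_divide_eq)
qed

lemma step_intervals_disjoint:
  fixes h :: real
  assumes "0 < h"
  shows "disjoint_family (\<lambda>n::nat. {real n * h<..(real n + 1) * h})"
proof -
  have "i = j" if "t \<in> {real i * h<..(real i + 1) * h}" "t \<in> {real j * h<..(real j + 1) * h}"
    for i j :: nat and t
  proof -
    have "real i * h < (real j + 1) * h" "real j * h < (real i + 1) * h"
      using that by auto
    then have "real i < real j + 1" "real j < real i + 1"
      using assms by (auto simp: mult_less_cancel_right)
    then show ?thesis by linarith
  qed
  then show ?thesis unfolding disjoint_family_on_def by blast
qed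

text \<open>Left-open cells are disjoint and cover exactly the positive half-line, matching the open
  ray \<open>y > x\<close> in the hypothesis; suprema and infima over the closed cells still bound
  \<open>g\<close> on them.\<close>

definition step_fun :: "(nat \<Rightarrow> real) \<Rightarrow> real \<Rightarrow> real \<Rightarrow> ennreal" where
  "step_fun a h t = (\<Sum>n. ennreal (a n) * indicator {real n * h<..(real n + 1) * h} t)"

lemma step_fun_measurable [measurable]: "step_fun a h \<in> borel_measurable borel"
  unfolding step_fun_def[abs_def] by measurable

lemma step_fun_eq:
  assumes "0 < h" "t \<in> {real n * h<..(real n + 1) * h}"
  shows "step_fun a h t = ennreal (a n)"
  unfolding step_fun_def
  using suminf_cmult_indicator[OF step_intervals_disjoint[OF assms(1)] assms(2), of "\<lambda>n. ennreal (a n)"] .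

lemma step_fun_nonpos: "0 < h \<Longrightarrow> t \<le> 0 \<Longrightarrow> step_fun a h t = 0"
proof -
  assume "0 < h" "t \<le> 0"
  then have "ennreal (a n) * indicator {real n * h<..(real n + 1) * h} t = 0" for n
    using mult_nonneg_nonneg[of "real n" h] by (auto simp: indicator_def simp del: mult_nonneg_nonneg)
  then show ?thesis by (simp only: step_fun_def suminf_zero)
qed

lemma nn_integral_step_fun:
  assumes "0 < h" "\<And>n. 0 \<le> a n" "summable a"
  shows "(\<integral>\<^sup>+t. step_fun a h t \<partial>lborel) = ennreal (h * (\<Sum>n. a n))"
proof -
  have "(\<integral>\<^sup>+t. step_fun a h t \<partial>lborel) =
      (\<Sum>n. ennreal (a n) * emeasure lborel {real n * h<..(real n + 1) * h})"
    unfolding step_fun_def by (subst nn_integral_suminf) (auto simp: nn_integral_cmult_indicator)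
  also have "\<dots> = (\<Sum>n. ennreal (h * a n))"
    using assms by (intro suminf_cong) (simp add: algebra_simps ennreal_mult)
  also have "\<dots> = ennreal (h * (\<Sum>n. a n))"
    using assms by (subst suminf_ennreal2) (auto simp: suminf_mult intro!: summable_mult)
  finally show ?thesis .
qed

text \<open>
  A function in \<^const>\<open>class_G\<close> need not be Borel measurable, and it may differ from \<open>\<phi>\<close> and \<open>\<psi>\<close> on a
  set charged by \<open>\<pi>\<close>; only after averaging over Lebesgue-almost all shifts are the three
  interchangeable (\<open>AE_shifted_integrals_eq\<close>).
\<close>

lemma dri_borel_sandwich:
  assumes g: "g \<in> class_G"
  obtains \<phi> \<psi> :: "real \<Rightarrow> ennreal"
  where "\<phi> \<in> borel_measurable borel" "\<psi> \<in> borel_measurable borel"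
    "\<And>t. t \<le> 0 \<Longrightarrow> \<phi> t = 0" "\<And>t. t \<le> 0 \<Longrightarrow> \<psi> t = 0"
    "\<And>t. 0 < t \<Longrightarrow> \<phi> t \<le> ennreal (g t)" "\<And>t. 0 < t \<Longrightarrow> ennreal (g t) \<le> \<psi> t"
    "AE t in lborel. \<phi> t = \<psi> t" "(\<integral>\<^sup>+t. \<phi> t \<partial>lborel) < \<infinity>"
proof -
  define J where "J h n = {real n * h..(real n + 1) * h}" for h :: real and n :: nat
  define u where "u h n = Sup (g ` J h n)" for h n
  define l where "l h n = Inf (g ` J h n)" for h n
  have g0: "0 \<le> g t" if "0 \<le> t" for t using g that by (auto simp: class_G_def)
  have dri: "directly_riemann_integrable g" using g by (simp add: class_G_def)
  have J0: "0 \<le> t" if "t \<in> J h n" "0 < h" for t h n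
    using that mult_nonneg_nonneg[of "real n" h] unfolding J_def by (auto simp del: mult_nonneg_nonneg)
  have Jne: "real n * h \<in> J h n" if "0 < h" for n h
    using that by (auto simp: J_def)
  have bdd: "bdd_above (g ` J h n)" "bdd_below (g ` J h n)" and su: "summable (u h)" "summable (l h)"
    if "0 < h" for h n
    using dri that by (auto simp: directly_riemann_integrable_def J_def u_def[abs_def] l_def[abs_def])
  have lim: "((\<lambda>h. upper_dri_sum g h - lower_dri_sum g h) \<longlongrightarrow> 0) (at_right 0)"
    using dri by (simp add: directly_riemann_integrable_def)
  have u0: "0 \<le> u h n" if "0 < h" for h n
    unfolding u_def using Jne[OF that, of n] bdd(1)[OF that, of n] g0 J0[OF _ that]
    by (intro cSup_upper2[of "g (real n * h)"]) auto
  have l0: "0 \<le> l h n" if "0 < h" for h n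
    unfolding l_def using Jne[OF that, of n] g0 J0[OF _ that]
    by (intro cInf_greatest) auto
  have gu: "ennreal (g t) \<le> step_fun (u h) h t" if "0 < h" "0 < t" for h t
  proof -
    obtain n where n: "t \<in> {real n * h<..(real n + 1) * h}"
      using step_interval_exists[OF \<open>0 < h\<close> \<open>0 < t\<close>] by blast
    then have "g t \<le> u h n"
      unfolding u_def using bdd(1)[OF that(1)] by (intro cSup_upper) (auto simp: J_def)
    with n show ?thesis by (simp add: step_fun_eq[OF that(1) n] ennreal_leI)
  qed
  have lg: "step_fun (l h) h t \<le> ennreal (g t)" if "0 < h" "0 < t" for h t
  proof -
    obtain n where n: "t \<in> {real n * h<..(real n + 1) * h}"
      using step_interval_exists[OF \<open>0 < h\<close> \<open>0 < t\<close>] by blast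
    then have "l h n \<le> g t"
      unfolding l_def using bdd(2)[OF that(1)] by (intro cInf_lower) (auto simp: J_def)
    with n show ?thesis by (simp add: step_fun_eq[OF that(1) n] ennreal_leI)
  qed
  have dri_sums: "upper_dri_sum g h = h * (\<Sum>n. u h n)" "lower_dri_sum g h = h * (\<Sum>n. l h n)" for h
    by (simp_all add: upper_dri_sum_def lower_dri_sum_def u_def l_def J_def)
  \<comment> \<open>Countably many meshes 1/(j + 1) tending to 0 keep the supremum \<phi> of the
    lower step functions and the infimum \<psi> of the upper ones Borel.\<close>
  define h where "h j = inverse (real (Suc j))" for j
  have h: "0 < h j" for j by (simp add: h_def)
  have "filterlim h (at_right 0) sequentially"
    unfolding filterlim_at using LIMSEQ_inverse_real_of_nat h
    by (auto simp: h_def[abs_def] eventually_sequentially)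
  from filterlim_compose[OF lim this]
  have lim': "(\<lambda>j. upper_dri_sum g (h j) - lower_dri_sum g (h j)) \<longlonglongrightarrow> 0" .
  define \<phi> where "\<phi> t = (SUP j. step_fun (l (h j)) (h j) t)" for t
  define \<psi> where "\<psi> t = (INF j. step_fun (u (h j)) (h j) t)" for t
  have [measurable]: "\<phi> \<in> borel_measurable borel" "\<psi> \<in> borel_measurable borel"
    unfolding \<phi>_def[abs_def] \<psi>_def[abs_def] by measurable
  have z: "\<phi> t = 0" "\<psi> t = 0" if "t \<le> 0" for t
    using that h by (auto simp: \<phi>_def \<psi>_def step_fun_nonpos)
  have lo: "\<phi> t \<le> ennreal (g t)" and hi: "ennreal (g t) \<le> \<psi> t" if "0 < t" for t
    unfolding \<phi>_def \<psi>_def using that lg gu h by (auto intro!: SUP_least INF_greatest)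
  have le: "\<phi> t \<le> \<psi> t" for t
    using lo[of t] hi[of t] z[of t] by (cases "0 < t") (auto intro: order_trans)
  have upper: "(\<integral>\<^sup>+t. \<psi> t \<partial>lborel) \<le> ennreal (upper_dri_sum g (h j))" for j
  proof -
    have "(\<integral>\<^sup>+t. \<psi> t \<partial>lborel) \<le> (\<integral>\<^sup>+t. step_fun (u (h j)) (h j) t \<partial>lborel)"
      unfolding \<psi>_def by (intro nn_integral_mono INF_lower) auto
    also have "\<dots> = ennreal (upper_dri_sum g (h j))"
      using h u0 su by (subst nn_integral_step_fun) (auto simp: dri_sums)
    finally show ?thesis .
  qed
  have lower: "ennreal (lower_dri_sum g (h j)) \<le> (\<integral>\<^sup>+t. \<phi> t \<partial>lborel)" for j
  proof -
    have "ennreal (lower_dri_sum g (h j)) = (\<integral>\<^sup>+t. step_fun (l (h j)) (h j) t \<partial>lborel)"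
      using h l0 su by (subst nn_integral_step_fun) (auto simp: dri_sums)
    also have "\<dots> \<le> (\<integral>\<^sup>+t. \<phi> t \<partial>lborel)"
      unfolding \<phi>_def by (intro nn_integral_mono SUP_upper) auto
    finally show ?thesis .
  qed
  have fin: "(\<integral>\<^sup>+t. \<psi> t \<partial>lborel) < \<infinity>"
    using upper[of 0] by (simp add: le_less_trans[OF _ ennreal_less_top])
  have fin\<phi>: "(\<integral>\<^sup>+t. \<phi> t \<partial>lborel) < \<infinity>"
    using fin le by (meson le_less_trans nn_integral_mono)
  \<comment> \<open>For every mesh the two integrals lie between the lower and the upper sum, whose
    difference tends to 0.\<close>
  have "(\<integral>\<^sup>+t. \<psi> t \<partial>lborel) \<le> (\<integral>\<^sup>+t. \<phi> t \<partial>lborel)"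
  proof (rule ennreal_le_epsilon)
    fix e :: real assume "0 < e"
    then have "eventually (\<lambda>j. upper_dri_sum g (h j) - lower_dri_sum g (h j) < e) sequentially"
      using lim' by (auto dest: order_tendstoD(2))
    then obtain j where j: "upper_dri_sum g (h j) - lower_dri_sum g (h j) < e"
      by (auto simp: eventually_sequentially)
    have l0': "0 \<le> lower_dri_sum g (h j)"
      using h[of j] l0[OF h[of j]] su[OF h[of j]]
      by (auto simp: dri_sums intro!: mult_nonneg_nonneg suminf_nonneg)
    have "(\<integral>\<^sup>+t. \<psi> t \<partial>lborel) \<le> ennreal (lower_dri_sum g (h j) + e)"
      using j by (intro order_trans[OF upper[of j]] ennreal_leI) simp
    also have "\<dots> = ennreal (lower_dri_sum g (h j)) + ennreal e"
      using l0' \<open>0 < e\<close> by (intro ennreal_plus) auto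
    also have "\<dots> \<le> (\<integral>\<^sup>+t. \<phi> t \<partial>lborel) + ennreal e"
      by (intro add_right_mono lower)
    finally show "(\<integral>\<^sup>+t. \<psi> t \<partial>lborel) \<le> (\<integral>\<^sup>+t. \<phi> t \<partial>lborel) + ennreal e" .
  qed
  then have "(\<integral>\<^sup>+t. \<psi> t - \<phi> t \<partial>lborel) = 0"
    using le fin\<phi> by (subst nn_integral_diff) (auto simp: diff_eq_0_ennreal less_top)
  then have "AE t in lborel. \<psi> t - \<phi> t = 0"
    by (subst (asm) nn_integral_0_iff_AE) auto
  then have "AE t in lborel. \<phi> t = \<psi> t"
    by eventually_elim (use le in \<open>auto simp: ennreal_minus_eq_0 intro: antisym\<close>)
  with fin\<phi> z lo hi show thesis by (intro that[of \<phi> \<psi>]) auto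
qed

section \<open>Convolution bounds\<close>

text \<open>Layer-cake formulas by Tonelli. Since \<open>ennreal\<close> cuts negative reals to 0,
  the right-hand sides are the means of the positive and of the negative part of a step.\<close>

lemma nn_integral_tail:
  fixes N :: "real measure"
  assumes "prob_space N" and sets_N: "sets N = sets borel"
  shows "(\<integral>\<^sup>+t. indicator {0..} t * emeasure N {t<..} \<partial>lborel) = (\<integral>\<^sup>+s. ennreal s \<partial>N)"
    and "(\<integral>\<^sup>+t. indicator {0<..} t * emeasure N {..- t} \<partial>lborel) = (\<integral>\<^sup>+s. ennreal (- s) \<partial>N)"
proof -
  interpret N: prob_space N by fact
  interpret LN: pair_sigma_finite lborel N ..
  note sets_N[measurable_cong]
  have "(\<integral>\<^sup>+t. indicator {0..} t * emeasure N {t<..} \<partial>lborel)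
      = (\<integral>\<^sup>+t. \<integral>\<^sup>+s. indicator {0..} t * indicator {t<..} s \<partial>N \<partial>lborel)"
    by (intro nn_integral_cong) (simp add: nn_integral_cmult)
  also have "\<dots> = (\<integral>\<^sup>+s. \<integral>\<^sup>+t. indicator {0..} t * indicator {t<..} s \<partial>lborel \<partial>N)"
    by (subst LN.Fubini') (auto simp: indicator_def)
  also have "\<dots> = (\<integral>\<^sup>+s. emeasure lborel {0..<s} \<partial>N)"
  proof (rule nn_integral_cong)
    fix s :: real
    have "(\<integral>\<^sup>+t. indicator {0..} t * indicator {t<..} s \<partial>lborel) = (\<integral>\<^sup>+t. indicator {0..<s} t \<partial>lborel)"
      by (rule nn_integral_cong) (auto simp: indicator_def)
    also have "\<dots> = emeasure lborel {0..<s}"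
      by (rule nn_integral_indicator) simp
    finally show "(\<integral>\<^sup>+t. indicator {0..} t * indicator {t<..} s \<partial>lborel) = emeasure lborel {0..<s}" .
  qed
  also have "\<dots> = (\<integral>\<^sup>+s. ennreal s \<partial>N)"
  proof (intro nn_integral_cong)
    show "emeasure lborel {0..<s} = ennreal s" for s :: real
      by (cases "0 \<le> s") (auto simp: ennreal_neg)
  qed
  finally show "(\<integral>\<^sup>+t. indicator {0..} t * emeasure N {t<..} \<partial>lborel) = (\<integral>\<^sup>+s. ennreal s \<partial>N)" .
  have "(\<integral>\<^sup>+t. indicator {0<..} t * emeasure N {..- t} \<partial>lborel)
      = (\<integral>\<^sup>+t. \<integral>\<^sup>+s. indicator {0<..} t * indicator {..- t} s \<partial>N \<partial>lborel)"
    by (intro nn_integral_cong) (simp add: nn_integral_cmult)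
  also have "\<dots> = (\<integral>\<^sup>+s. \<integral>\<^sup>+t. indicator {0<..} t * indicator {..- t} s \<partial>lborel \<partial>N)"
    by (subst LN.Fubini') (auto simp: indicator_def)
  also have "\<dots> = (\<integral>\<^sup>+s. emeasure lborel {0<..- s} \<partial>N)"
  proof (rule nn_integral_cong)
    fix s :: real
    have "(\<integral>\<^sup>+t. indicator {0<..} t * indicator {..- t} s \<partial>lborel) = (\<integral>\<^sup>+t. indicator {0<..- s} t \<partial>lborel)"
      by (rule nn_integral_cong) (auto simp: indicator_def)
    also have "\<dots> = emeasure lborel {0<..- s}"
      by (rule nn_integral_indicator) simp
    finally show "(\<integral>\<^sup>+t. indicator {0<..} t * indicator {..- t} s \<partial>lborel) = emeasure lborel {0<..- s}" .
  qed
  also have "\<dots> = (\<integral>\<^sup>+s. ennreal (- s) \<partial>N)"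
  proof (intro nn_integral_cong)
    show "emeasure lborel {0<..- s} = ennreal (- s)" for s :: real
      by (cases "0 \<le> - s") (auto simp: ennreal_neg)
  qed
  finally show "(\<integral>\<^sup>+t. indicator {0<..} t * emeasure N {..- t} \<partial>lborel) = (\<integral>\<^sup>+s. ennreal (- s) \<partial>N)" .
qed

section \<open>Smoothing the balance by \<phi>\<close>

lemma nn_integral_reflect:
  fixes f :: "real \<Rightarrow> ennreal"
  assumes [measurable]: "f \<in> borel_measurable borel"
  shows "(\<integral>\<^sup>+z. f z \<partial>lborel) = (\<integral>\<^sup>+t. f (y - t) \<partial>lborel)"
  using nn_integral_real_affine[of f "-1" y] by simp

text \<open>Weight the balance at level \<open>x + t\<close> by \<open>\<phi> t\<close>, integrate
  over \<open>t\<close> and exchange integrals. Starting points \<open>y \<le> A\<close> form the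
  second term on the left; those above \<open>A\<close> are only bounded below, by the pairs with
  \<open>y - t\<close> in \<open>[A, x]\<close>.\<close>

lemma smoothed_balance_inequality:
  fixes N \<pi> :: "real measure" and \<phi> :: "real \<Rightarrow> ennreal" and A x :: real
  assumes "prob_space N" and sets_N: "sets N = sets borel"
    and "prob_space \<pi>" and sets_\<pi>: "sets \<pi> = sets borel"
    and balance: "\<And>x. 0 \<le> x \<Longrightarrow>
      (\<integral>\<^sup>+y. indicator {..x} y * emeasure N {x - y<..} \<partial>\<pi>) \<le>
      (\<integral>\<^sup>+y. indicator {x<..} y * emeasure N {..x - y} \<partial>\<pi>)"
    and \<phi>[measurable]: "\<phi> \<in> borel_measurable borel" and \<phi>0: "\<And>t. t \<le> 0 \<Longrightarrow> \<phi> t = 0"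
    and A: "A \<le> x" and x: "0 \<le> x"
  shows "(\<integral>\<^sup>+z. indicator {A..x} z * emeasure N {x - z<..} * (\<integral>\<^sup>+y. \<phi> (y - z) \<partial>\<pi>) \<partial>lborel)
      + (\<integral>\<^sup>+t. \<phi> t * (\<integral>\<^sup>+y. indicator {..A} y * emeasure N {x + t - y<..} \<partial>\<pi>) \<partial>lborel)
    \<le> (\<integral>\<^sup>+s. indicator {0<..} s * emeasure N {..- s} * (\<integral>\<^sup>+y. \<phi> (y - (x + s)) \<partial>\<pi>) \<partial>lborel)"
proof -
  interpret N: prob_space N by fact
  interpret \<pi>: prob_space \<pi> by fact
  interpret L\<pi>: pair_sigma_finite lborel \<pi> ..
  note sets_N[measurable_cong] sets_\<pi>[measurable_cong]
  define H where "H u = emeasure N {u<..}" for u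
  define L where "L u = emeasure N {..u}" for u
  have [measurable]: "H \<in> borel_measurable borel" "L \<in> borel_measurable borel"
    unfolding H_def[abs_def] L_def[abs_def]
    by (auto intro!: N.measurable_emeasure simp: sets_eq_imp_space_eq[OF sets_N])
  have "(\<integral>\<^sup>+z. indicator {A..x} z * H (x - z) * (\<integral>\<^sup>+y. \<phi> (y - z) \<partial>\<pi>) \<partial>lborel)
      = (\<integral>\<^sup>+z. \<integral>\<^sup>+y. indicator {A..x} z * H (x - z) * \<phi> (y - z) \<partial>\<pi> \<partial>lborel)"
    by (simp add: nn_integral_cmult)
  also have "\<dots> = (\<integral>\<^sup>+y. \<integral>\<^sup>+z. indicator {A..x} z * H (x - z) * \<phi> (y - z) \<partial>lborel \<partial>\<pi>)"
    by (subst L\<pi>.Fubini') auto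
  also have "\<dots> = (\<integral>\<^sup>+y. \<integral>\<^sup>+t. indicator {A..x} (y - t) * H (x - (y - t)) * \<phi> t \<partial>lborel \<partial>\<pi>)"
  proof (rule nn_integral_cong)
    fix y
    show "(\<integral>\<^sup>+z. indicator {A..x} z * H (x - z) * \<phi> (y - z) \<partial>lborel)
        = (\<integral>\<^sup>+t. indicator {A..x} (y - t) * H (x - (y - t)) * \<phi> t \<partial>lborel)"
      by (subst nn_integral_reflect[where y = y]) auto
  qed
  \<comment> \<open>With z = y - t, the bounds \<open>t > 0\<close> and \<open>A \<le> y - t\<close>
    force \<open>y > A\<close>; then the condition \<open>A \<le> y - t\<close> is dropped. For
    \<open>t \<le> 0\<close> the weight vanishes.\<close>
  also have "\<dots> \<le> (\<integral>\<^sup>+y. \<integral>\<^sup>+t. \<phi> t * (indicator {A<..} y * indicator {..x} (y - t) * H (x + t - y)) \<partial>lborel \<partial>\<pi>)"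
  proof (intro nn_integral_mono)
    fix y t
    show "indicator {A..x} (y - t) * H (x - (y - t)) * \<phi> t \<le> \<phi> t * (indicator {A<..} y * indicator {..x} (y - t) * H (x + t - y))"
      using \<phi>0[of t] by (cases "t \<le> 0") (auto simp: indicator_def algebra_simps)
  qed
  also have "\<dots> = (\<integral>\<^sup>+t. \<integral>\<^sup>+y. \<phi> t * (indicator {A<..} y * indicator {..x} (y - t) * H (x + t - y)) \<partial>\<pi> \<partial>lborel)"
    by (subst L\<pi>.Fubini') auto
  also have "\<dots> = (\<integral>\<^sup>+t. \<phi> t * (\<integral>\<^sup>+y. indicator {A<..} y * indicator {..x} (y - t) * H (x + t - y) \<partial>\<pi>) \<partial>lborel)"
    by (simp add: nn_integral_cmult)
  finally have "(\<integral>\<^sup>+z. indicator {A..x} z * H (x - z) * (\<integral>\<^sup>+y. \<phi> (y - z) \<partial>\<pi>) \<partial>lborel)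
      + (\<integral>\<^sup>+t. \<phi> t * (\<integral>\<^sup>+y. indicator {..A} y * H (x + t - y) \<partial>\<pi>) \<partial>lborel)
    \<le> (\<integral>\<^sup>+t. \<phi> t * (\<integral>\<^sup>+y. indicator {A<..} y * indicator {..x} (y - t) * H (x + t - y) \<partial>\<pi>) \<partial>lborel)
      + (\<integral>\<^sup>+t. \<phi> t * (\<integral>\<^sup>+y. indicator {..A} y * H (x + t - y) \<partial>\<pi>) \<partial>lborel)"
    by (rule add_right_mono)
  also have "\<dots> = (\<integral>\<^sup>+t. \<phi> t * ((\<integral>\<^sup>+y. indicator {A<..} y * indicator {..x} (y - t) * H (x + t - y) \<partial>\<pi>)
      + (\<integral>\<^sup>+y. indicator {..A} y * H (x + t - y) \<partial>\<pi>)) \<partial>lborel)"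
    by (subst nn_integral_add[symmetric]) (auto simp: distrib_left)
  also have "\<dots> \<le> (\<integral>\<^sup>+t. \<phi> t * (\<integral>\<^sup>+y. indicator {x<..} (y - t) * L (x + t - y) \<partial>\<pi>) \<partial>lborel)"
  proof (rule nn_integral_mono)
    fix t
    show "\<phi> t * ((\<integral>\<^sup>+y. indicator {A<..} y * indicator {..x} (y - t) * H (x + t - y) \<partial>\<pi>)
        + (\<integral>\<^sup>+y. indicator {..A} y * H (x + t - y) \<partial>\<pi>))
      \<le> \<phi> t * (\<integral>\<^sup>+y. indicator {x<..} (y - t) * L (x + t - y) \<partial>\<pi>)"
    proof (cases "t \<le> 0")
      case False
      \<comment> \<open>As \<open>A \<le> x\<close> and \<open>t > 0\<close>, the two ranges
        partition \<open>y \<le> x + t\<close>, so the balance at level \<open>x + t\<close>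
        applies.\<close>
      have "(\<integral>\<^sup>+y. indicator {A<..} y * indicator {..x} (y - t) * H (x + t - y) \<partial>\<pi>)
          + (\<integral>\<^sup>+y. indicator {..A} y * H (x + t - y) \<partial>\<pi>)
        = (\<integral>\<^sup>+y. indicator {..x} (y - t) * H (x + t - y) \<partial>\<pi>)"
        using False A
        by (subst nn_integral_add[symmetric]) (auto intro!: nn_integral_cong simp: indicator_def)
      also have "\<dots> \<le> (\<integral>\<^sup>+y. indicator {x<..} (y - t) * L (x + t - y) \<partial>\<pi>)"
        using balance[of "x + t"] False x by (simp add: H_def L_def indicator_def diff_le_eq less_diff_eq add.commute)
      finally show ?thesis by (rule mult_left_mono) simp
    qed (simp add: \<phi>0)
  qed
  also have "\<dots> = (\<integral>\<^sup>+t. \<integral>\<^sup>+y. \<phi> t * (indicator {x<..} (y - t) * L (x + t - y)) \<partial>\<pi> \<partial>lborel)"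
    by (simp add: nn_integral_cmult)
  also have "\<dots> = (\<integral>\<^sup>+y. \<integral>\<^sup>+t. \<phi> t * (indicator {x<..} (y - t) * L (x + t - y)) \<partial>lborel \<partial>\<pi>)"
    by (subst L\<pi>.Fubini') auto
  \<comment> \<open>The substitution s = y - (x + t) uses the excess of \<open>y\<close> over the
    level, which a down-crossing step has to undo.\<close>
  also have "\<dots> = (\<integral>\<^sup>+y. \<integral>\<^sup>+s. indicator {0<..} s * L (- s) * \<phi> (y - (x + s)) \<partial>lborel \<partial>\<pi>)"
  proof (rule nn_integral_cong)
    fix y
    show "(\<integral>\<^sup>+t. \<phi> t * (indicator {x<..} (y - t) * L (x + t - y)) \<partial>lborel)
        = (\<integral>\<^sup>+s. indicator {0<..} s * L (- s) * \<phi> (y - (x + s)) \<partial>lborel)"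
      by (subst nn_integral_reflect[where y = "y - x"])
         (auto intro!: nn_integral_cong simp: indicator_def algebra_simps)
  qed
  also have "\<dots> = (\<integral>\<^sup>+s. \<integral>\<^sup>+y. indicator {0<..} s * L (- s) * \<phi> (y - (x + s)) \<partial>\<pi> \<partial>lborel)"
    by (subst L\<pi>.Fubini') auto
  also have "\<dots> = (\<integral>\<^sup>+s. indicator {0<..} s * L (- s) * (\<integral>\<^sup>+y. \<phi> (y - (x + s)) \<partial>\<pi>) \<partial>lborel)"
    by (simp add: nn_integral_cmult)
  finally show ?thesis unfolding H_def L_def .
qed

section \<open>The two halves of the convolution asymptotics\<close>

lemma ennreal_affine_le_imp:
  assumes "0 < c" "0 \<le> k" "0 \<le> r" and le: "ennreal c * J + ennreal k \<le> ennreal r"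
  shows "J \<le> ennreal ((r - k) / c)"
proof (cases J)
  case (real j)
  then have "ennreal (c * j + k) = ennreal c * J + ennreal k"
    using assms by (simp add: ennreal_mult)
  then have "ennreal (c * j + k) \<le> ennreal r" using le by simp
  then have "c * j + k \<le> r" using assms by (simp add: ennreal_le_iff)
  then have "j \<le> (r - k) / c" using assms by (simp add: field_simps)
  with real show ?thesis by (simp add: ennreal_leI)
next
  case top
  then show ?thesis using le assms by (simp add: ennreal_mult_top top_unique)
qed

text \<open>Inserting the bounds on the smoothed integral into the smoothed balance gives c J + k
  \<le> r, with \<open>J\<close> the convolution integral over \<open>[A, x]\<close>. As the error
  \<open>e\<close> tends to 0, (r - k)/c tends to \<open>mp * T x\<close>; the range
  \<open>[0, A]\<close> adds at most \<open>(1 + e) * mp * T x\<close> by long-tailedness.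
  \<open>G\<close> is assumed for almost every \<open>z\<close>, which is all that Lebesgue
  integrals see.\<close>

lemma convolution_upper_bound:
  fixes N \<pi> :: "real measure" and \<phi> :: "real \<Rightarrow> ennreal" and T :: "real \<Rightarrow> real" and m mp I :: real
  assumes "prob_space N" and sets_N: "sets N = sets borel"
    and "prob_space \<pi>" and sets_\<pi>: "sets \<pi> = sets borel"
    and \<pi>_nonneg: "emeasure \<pi> {0..} = 1"
    and balance: "\<And>x. 0 \<le> x \<Longrightarrow>
      (\<integral>\<^sup>+y. indicator {..x} y * emeasure N {x - y<..} \<partial>\<pi>) \<le>
      (\<integral>\<^sup>+y. indicator {x<..} y * emeasure N {..x - y} \<partial>\<pi>)"
    and \<phi>[measurable]: "\<phi> \<in> borel_measurable borel" and \<phi>0: "\<And>t. t \<le> 0 \<Longrightarrow> \<phi> t = 0"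
    and int_\<phi>: "(\<integral>\<^sup>+t. \<phi> t \<partial>lborel) = ennreal I"
    and T: "\<And>x. emeasure N {x<..} = ennreal (T x)" and T_pos: "\<And>x. 0 < T x"
    and long: "\<And>c. 0 < c \<Longrightarrow> ((\<lambda>x. T (x - c) / T x) \<longlongrightarrow> 1) at_top"
    and mp: "(\<integral>\<^sup>+t. indicator {0..} t * emeasure N {t<..} \<partial>lborel) = ennreal mp"
    and mm: "(\<integral>\<^sup>+t. indicator {0<..} t * emeasure N {..- t} \<partial>lborel) = ennreal (mp + m)"
    and pos: "0 < m" "0 \<le> mp" "0 < I"
    and G: "\<And>e. 0 < e \<Longrightarrow> \<exists>x0. AE z in lborel. x0 \<le> z \<longrightarrow>
      ennreal ((1 - e) * (I / m) * T z) \<le> (\<integral>\<^sup>+y. \<phi> (y - z) \<partial>\<pi>) \<and>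
      (\<integral>\<^sup>+y. \<phi> (y - z) \<partial>\<pi>) \<le> ennreal ((1 + e) * (I / m) * T z)"
    and \<delta>: "0 < \<delta>"
  shows "\<forall>\<^sub>F x in at_top. (\<integral>\<^sup>+z. indicator {0..x} z * (emeasure N {x - z<..} * emeasure N {z<..}) \<partial>lborel)
    \<le> ennreal ((2 * mp + \<delta>) * T x)"
proof -
  interpret N: prob_space N by fact
  interpret \<pi>: prob_space \<pi> by fact
  note sets_N[measurable_cong] sets_\<pi>[measurable_cong]
  define H where "H u = emeasure N {u<..}" for u
  define L where "L u = emeasure N {..u}" for u
  define Gf where "Gf z = (\<integral>\<^sup>+y. \<phi> (y - z) \<partial>\<pi>)" for z
  have [measurable]: "H \<in> borel_measurable borel" "L \<in> borel_measurable borel"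
    unfolding H_def[abs_def] L_def[abs_def]
    by (auto intro!: N.measurable_emeasure simp: sets_eq_imp_space_eq[OF sets_N])
  have [measurable]: "Gf \<in> borel_measurable borel"
    unfolding Gf_def[abs_def] by measurable
  have H_mono: "H y \<le> H x" if "x \<le> y" for x y
    unfolding H_def using that by (intro emeasure_mono) auto
  have HT: "H x = ennreal (T x)" for x by (simp add: H_def T)
  have "T = (\<lambda>x. enn2real (H x))" using T_pos by (simp add: HT less_imp_le)
  then have [measurable]: "T \<in> borel_measurable borel" by simp
  have T_mono: "T y \<le> T x" if "x \<le> y" for x y
    using H_mono[OF that] T_pos[of x] by (simp add: HT ennreal_le_iff)
  \<comment> \<open>This is the coefficient of \<open>T x\<close> reached at the end: the first
    summand comes from \<open>[0, A]\<close>, the bracket is (r - k)/c. Its value at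
    \<open>e = 0\<close> is \<open>2 * mp\<close>.\<close>
  have "((\<lambda>e. (1 + e) * mp + ((mp + m) * (1 + e) / (1 - e) - m * (1 - e) ^ 2)) \<longlongrightarrow>
      (1 + 0) * mp + ((mp + m) * (1 + 0) / (1 - 0) - m * (1 - 0) ^ 2)) (at_right 0)"
    by (intro tendsto_intros) auto
  then have "\<forall>\<^sub>F e in at_right 0. (1 + e) * mp + ((mp + m) * (1 + e) / (1 - e) - m * (1 - e) ^ 2) < 2 * mp + \<delta>"
    using \<delta> by (intro order_tendstoD(2)) auto
  moreover have "\<forall>\<^sub>F e in at_right (0::real). e < 1 \<and> 0 < e"
    using eventually_at_right_real[of 0 1] by (auto elim!: eventually_mono)
  ultimately have "\<forall>\<^sub>F e in at_right 0. (1 + e) * mp + ((mp + m) * (1 + e) / (1 - e) - m * (1 - e) ^ 2) < 2 * mp + \<delta> \<and> e < 1 \<and> 0 < e"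
    by (rule eventually_conj)
  then obtain e where e: "0 < e" "e < 1"
      and e\<delta>: "(1 + e) * mp + ((mp + m) * (1 + e) / (1 - e) - m * (1 - e) ^ 2) < 2 * mp + \<delta>"
    using eventually_happens'[OF trivial_limit_at_right_real] by blast
  obtain x0 where x0: "AE z in lborel. x0 \<le> z \<longrightarrow> ennreal ((1 - e) * (I / m) * T z) \<le> Gf z \<and>
      Gf z \<le> ennreal ((1 + e) * (I / m) * T z)"
    using G[OF e(1)] unfolding Gf_def by blast
  \<comment> \<open>\<open>A\<close> lies beyond \<open>x0\<close>, so that the bounds on
    \<open>Gf\<close> hold almost everywhere on \<open>[A, \<infinity>)\<close>, and carries almost
    all mass of \<pi> to its left.\<close>
  obtain A where A: "x0 \<le> A" "0 \<le> A" "1 - e < measure \<pi> {0..A}"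
  proof -
    have "(\<lambda>n. measure \<pi> {0..real n}) \<longlonglongrightarrow> measure \<pi> (\<Union>n. {0..real n})"
      by (rule \<pi>.finite_Lim_measure_incseq) (auto simp: incseq_def)
    also have "(\<Union>n. {0..real n}) = {0..}"
      by (auto intro: real_arch_simple)
    also have "measure \<pi> {0..} = 1"
      using \<pi>_nonneg by (simp add: measure_def)
    finally have "\<forall>\<^sub>F n in sequentially. 1 - e < measure \<pi> {0..real n}"
      by (rule order_tendstoD(1)) (use e in simp)
    moreover have "\<forall>\<^sub>F n in sequentially. max x0 0 \<le> real n"
      using filterlim_real_sequentially by (simp add: filterlim_at_top)
    ultimately have "\<forall>\<^sub>F n in sequentially. 1 - e < measure \<pi> {0..real n} \<and> max x0 0 \<le> real n"
      by (rule eventually_conj)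
    then show thesis using that by (force simp: eventually_sequentially)
  qed
  \<comment> \<open>Cutting \<phi> at \<open>R\<close> loses little mass and bounds the shift, so
    that \<open>T (x + t)\<close> can be compared with \<open>T x\<close> uniformly in
    \<open>t \<le> R\<close>.\<close>
  obtain R where R: "0 < R" "ennreal ((1 - e) * I) \<le> (\<integral>\<^sup>+t. \<phi> t * indicator {..R} t \<partial>lborel)"
  proof -
    let ?D = "density lborel \<phi>"
    have "(\<lambda>n. emeasure ?D {..real n}) \<longlonglongrightarrow> emeasure ?D (\<Union>n. {..real n})"
      by (rule Lim_emeasure_incseq) (auto simp: incseq_def)
    also have "(\<Union>n. {..real n}) = UNIV"
      by (auto intro: real_arch_simple)
    also have "emeasure ?D UNIV = ennreal I"
      by (subst emeasure_density) (auto simp: int_\<phi>)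
    finally have "\<forall>\<^sub>F n in sequentially. ennreal ((1 - e) * I) < emeasure ?D {..real n}"
      by (rule order_tendstoD(1)) (use e pos in \<open>simp add: ennreal_less_iff\<close>)
    moreover have "\<forall>\<^sub>F n in sequentially. 1 \<le> real n"
      using filterlim_real_sequentially by (simp add: filterlim_at_top)
    ultimately have "\<forall>\<^sub>F n in sequentially. ennreal ((1 - e) * I) < emeasure ?D {..real n} \<and> 1 \<le> real n"
      by (rule eventually_conj)
    then obtain n where n: "ennreal ((1 - e) * I) < emeasure ?D {..real n}" "1 \<le> real n"
      by (force simp: eventually_sequentially)
    then show thesis
      by (intro that[of "real n"]) (auto simp: emeasure_density)
  qed
  have "\<forall>\<^sub>F x in at_top. T (x - A) / T x < 1 + e"
  proof (cases "A = 0")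
    case True
    then show ?thesis using e T_pos[THEN less_imp_neq] by (simp add: less_imp_neq[symmetric] eventuallyI)
  next
    case False
    with A e show ?thesis by (intro order_tendstoD(2)[OF long]) auto
  qed
  \<comment> \<open>Long-tailedness is stated for left shifts; the right shift follows by taking
    reciprocals and replacing \<open>x\<close> by \<open>x + R\<close>.\<close>
  moreover have "\<forall>\<^sub>F x in at_top. 1 - e < T (x + R) / T x"
  proof -
    have "((\<lambda>x. inverse (T (x - R) / T x)) \<longlongrightarrow> inverse 1) at_top"
      by (intro tendsto_inverse long R) simp
    then have "((\<lambda>x. T x / T (x - R)) \<longlongrightarrow> 1) at_top"
      by simp
    then have "((\<lambda>x. T (x + R) / T (x + R - R)) \<longlongrightarrow> 1) at_top"
      by (rule filterlim_compose[where g = "\<lambda>x. T x / T (x - R)"])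
         (auto intro!: filterlim_tendsto_add_at_top[where f = "\<lambda>_. R" and c = R, unfolded add.commute[of R]] filterlim_ident)
    then show ?thesis using e by (intro order_tendstoD(1)) auto
  qed
  moreover have "\<forall>\<^sub>F x in at_top. A \<le> x" by (rule eventually_ge_at_top)
  ultimately show ?thesis
  proof eventually_elim
    case (elim x)
    have TA: "T (x - A) \<le> (1 + e) * T x" and TR: "(1 - e) * T x \<le> T (x + R)"
      using elim T_pos[of x] by (auto simp: field_simps)
    \<comment> \<open>\<open>c * T z\<close> bounds \<open>Gf z\<close> from below. \<open>k\<close>
      multiplies three lower bounds: the mass of \<phi> up to \<open>R\<close>,
      \<open>T (x + R)\<close>, and the \<pi>-mass of \<open>[0, A]\<close>. \<open>r\<close> is the
      mean \<open>mp + m\<close> of the negative part times the upper bound on \<open>Gf\<close>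
      beyond \<open>x\<close>.\<close>
    define J where "J = (\<integral>\<^sup>+z. indicator {A..x} z * (H (x - z) * H z) \<partial>lborel)"
    define c where "c = (1 - e) * (I / m)"
    define k where "k = (1 - e) * I * ((1 - e) * T x * (1 - e))"
    define r where "r = (mp + m) * ((1 + e) * (I / m) * T x)"
    have c: "0 < c" using e pos by (simp add: c_def)
    have k: "0 \<le> k" using e pos T_pos[of x] by (simp add: k_def less_imp_le)
    have r: "0 \<le> r" using e pos T_pos[of x] by (simp add: r_def less_imp_le)
    have "ennreal c * J = (\<integral>\<^sup>+z. indicator {A..x} z * H (x - z) * ennreal (c * T z) \<partial>lborel)"
      unfolding J_def using c
      by (subst nn_integral_cmult[symmetric]) (auto intro!: nn_integral_cong simp: HT ennreal_mult' mult_ac)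
    also have "\<dots> \<le> (\<integral>\<^sup>+z. indicator {A..x} z * H (x - z) * Gf z \<partial>lborel)"
      by (rule nn_integral_mono_AE, use x0 in eventually_elim)
         (use A in \<open>auto simp: indicator_def c_def intro!: mult_left_mono\<close>)
    finally have 1: "ennreal c * J \<le> (\<integral>\<^sup>+z. indicator {A..x} z * H (x - z) * Gf z \<partial>lborel)" .
    have "ennreal k = ennreal ((1 - e) * I) * (ennreal ((1 - e) * T x) * ennreal (1 - e))"
      unfolding k_def using e pos T_pos[of x] by (simp add: ennreal_mult' less_imp_le mult_ac)
    also have "\<dots> \<le> (\<integral>\<^sup>+t. \<phi> t * indicator {..R} t \<partial>lborel) * (H (x + R) * emeasure \<pi> {0..A})"
      using R(2) TR A(3) by (intro mult_mono) (auto simp: HT \<pi>.emeasure_eq_measure intro!: ennreal_leI)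
    also have "\<dots> = (\<integral>\<^sup>+t. \<phi> t * indicator {..R} t * (H (x + R) * emeasure \<pi> {0..A}) \<partial>lborel)"
      by (subst nn_integral_multc) auto
    also have "\<dots> \<le> (\<integral>\<^sup>+t. \<phi> t * (\<integral>\<^sup>+y. indicator {..A} y * H (x + t - y) \<partial>\<pi>) \<partial>lborel)"
    proof (rule nn_integral_mono)
      fix t
      have "H (x + R) * emeasure \<pi> {0..A} \<le> (\<integral>\<^sup>+y. indicator {..A} y * H (x + t - y) \<partial>\<pi>)" if "t \<le> R"
      proof -
        have "H (x + R) * emeasure \<pi> {0..A} = (\<integral>\<^sup>+y. H (x + R) * indicator {0..A} y \<partial>\<pi>)"
          by (subst nn_integral_cmult_indicator) auto
        also have "\<dots> \<le> (\<integral>\<^sup>+y. indicator {..A} y * H (x + t - y) \<partial>\<pi>)"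
          using that by (intro nn_integral_mono) (auto simp: indicator_def intro!: H_mono)
        finally show ?thesis .
      qed
      then show "\<phi> t * indicator {..R} t * (H (x + R) * emeasure \<pi> {0..A})
          \<le> \<phi> t * (\<integral>\<^sup>+y. indicator {..A} y * H (x + t - y) \<partial>\<pi>)"
        by (auto simp: indicator_def intro!: mult_left_mono)
    qed
    finally have 2: "ennreal k \<le> (\<integral>\<^sup>+t. \<phi> t * (\<integral>\<^sup>+y. indicator {..A} y * H (x + t - y) \<partial>\<pi>) \<partial>lborel)" .
    \<comment> \<open>Translation invariance of Lebesgue measure moves the exceptional null set
      along with \<open>x\<close>.\<close>
    have shift: "AE s in lborel. x0 \<le> x + s \<longrightarrow> Gf (x + s) \<le> ennreal ((1 + e) * (I / m) * T (x + s))"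
    proof -
      have "AE z in distr lborel borel ((+) x). x0 \<le> z \<longrightarrow> Gf z \<le> ennreal ((1 + e) * (I / m) * T z)"
        unfolding lborel_distr_plus using x0 by eventually_elim auto
      then show ?thesis
        by (subst (asm) AE_distr_iff) (auto simp: HT[symmetric])
    qed
    have "(\<integral>\<^sup>+s. indicator {0<..} s * L (- s) * Gf (x + s) \<partial>lborel)
      \<le> (\<integral>\<^sup>+s. indicator {0<..} s * L (- s) * ennreal ((1 + e) * (I / m) * T x) \<partial>lborel)"
    proof (rule nn_integral_mono_AE, use shift in eventually_elim)
      case (elim s)
      have "Gf (x + s) \<le> ennreal ((1 + e) * (I / m) * T x)" if "0 < s"
      proof -
        have "Gf (x + s) \<le> ennreal ((1 + e) * (I / m) * T (x + s))"
          using elim A \<open>A \<le> x\<close> that by simp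
        also have "\<dots> \<le> ennreal ((1 + e) * (I / m) * T x)"
          using that e pos by (intro ennreal_leI mult_left_mono T_mono) auto
        finally show ?thesis .
      qed
      then show ?case by (auto simp: indicator_def intro!: mult_left_mono)
    qed
    also have "\<dots> = ennreal (mp + m) * ennreal ((1 + e) * (I / m) * T x)"
      using mm by (subst nn_integral_multc) (simp_all add: L_def[symmetric] del: ennreal_plus)
    also have "\<dots> = ennreal r"
      unfolding r_def using pos by (intro ennreal_mult'[symmetric]) simp
    finally have 3: "(\<integral>\<^sup>+s. indicator {0<..} s * L (- s) * Gf (x + s) \<partial>lborel) \<le> ennreal r" .
    have "ennreal c * J + ennreal k
      \<le> (\<integral>\<^sup>+s. indicator {0<..} s * L (- s) * Gf (x + s) \<partial>lborel)"
      by (rule order_trans[OF add_mono[OF 1 2]])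
         (use smoothed_balance_inequality[OF assms(1-4) balance \<phi> \<phi>0 \<open>A \<le> x\<close>] A \<open>A \<le> x\<close>
           in \<open>simp add: H_def L_def Gf_def\<close>)
    from ennreal_affine_le_imp[OF c k r order_trans[OF this 3]]
    have J: "J \<le> ennreal ((r - k) / c)" .
    have rk: "(r - k) / c = ((mp + m) * (1 + e) / (1 - e) - m * (1 - e) ^ 2) * T x"
      using e pos unfolding r_def k_def c_def by (simp add: field_simps power2_eq_square)
    \<comment> \<open>Makes (r - k)/c nonnegative, so that the final sum can be merged under one
      \<open>ennreal\<close>.\<close>
    have "k \<le> r"
    proof -
      have "k = (1 - e) ^ 3 * (m * (I / m) * T x)" using pos by (simp add: k_def power3_eq_cube)
      also have "\<dots> \<le> 1 * (m * (I / m) * T x)"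
        using e pos T_pos[of x] by (intro mult_right_mono) (auto simp: power_le_one less_imp_le)
      also have "\<dots> \<le> (mp + m) * ((1 + e) * (I / m) * T x)"
      proof -
        have "m * (I / m * T x) \<le> (mp + m) * (I / m * T x)"
          using pos T_pos[of x] by (intro mult_right_mono) (auto simp: less_imp_le)
        also have "\<dots> \<le> (mp + m) * ((1 + e) * (I / m * T x))"
          using pos T_pos[of x] e mult_right_mono[of 1 "1 + e" "I / m * T x"]
          by (intro mult_left_mono) (auto simp: less_imp_le)
        finally show ?thesis by (simp only: mult.assoc mult_1_left)
      qed
      finally show ?thesis by (simp add: r_def)
    qed
    \<comment> \<open>Split at \<open>A\<close>: for \<open>z \<le> A\<close> the first factor is at
      most \<open>H (x - A)\<close>, and the second integrates to at most \<open>mp\<close>.\<close>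
    have "(\<integral>\<^sup>+z. indicator {0..x} z * (H (x - z) * H z) \<partial>lborel)
      \<le> (\<integral>\<^sup>+z. H (x - A) * (indicator {0..} z * H z) + indicator {A..x} z * (H (x - z) * H z) \<partial>lborel)"
      by (intro nn_integral_mono) (auto simp: indicator_def intro!: mult_right_mono H_mono add_increasing2)
    also have "\<dots> = (\<integral>\<^sup>+z. H (x - A) * (indicator {0..} z * H z) \<partial>lborel) + J"
      unfolding J_def by (rule nn_integral_add) measurable
    also have "(\<integral>\<^sup>+z. H (x - A) * (indicator {0..} z * H z) \<partial>lborel) = H (x - A) * ennreal mp"
      using mp by (subst nn_integral_cmult) (simp_all add: H_def[symmetric])
    also have "H (x - A) * ennreal mp + J \<le> ennreal ((1 + e) * T x) * ennreal mp + ennreal ((r - k) / c)"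
      unfolding HT by (intro add_mono mult_right_mono ennreal_leI TA J) simp
    also have "\<dots> = ennreal ((1 + e) * T x * mp + (r - k) / c)"
    proof -
      have "0 \<le> (1 + e) * T x" "0 \<le> (r - k) / c"
        using e pos T_pos[of x] \<open>k \<le> r\<close> c by (simp_all add: less_imp_le)
      then show ?thesis using pos by (simp only: ennreal_plus ennreal_mult mult_nonneg_nonneg)
    qed
    also have "\<dots> = ennreal (((1 + e) * mp + ((mp + m) * (1 + e) / (1 - e) - m * (1 - e) ^ 2)) * T x)"
      unfolding rk by (simp add: algebra_simps)
    also have "\<dots> \<le> ennreal ((2 * mp + \<delta>) * T x)"
      using e\<delta> T_pos[of x] by (intro ennreal_leI mult_right_mono) auto
    finally show ?case by (simp add: H_def)
  qed
qed

text \<open>The elementary half. On \<open>[0, B]\<close> monotonicity gives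
  \<open>T (x - z) \<ge> T x\<close>, so this block contributes at least \<open>T x\<close> times
  almost \<open>mp\<close>. Reflection at x/2 gives the same for \<open>[x - B, x]\<close>, and
  \<open>x > 2 * B\<close> makes the blocks disjoint.\<close>

lemma convolution_lower_bound:
  fixes N :: "real measure" and T :: "real \<Rightarrow> real" and mp \<delta> :: real
  assumes "prob_space N" and sets_N: "sets N = sets borel"
    and T: "\<And>x. emeasure N {x<..} = ennreal (T x)" and T_pos: "\<And>x. 0 < T x"
    and mp: "(\<integral>\<^sup>+t. indicator {0..} t * emeasure N {t<..} \<partial>lborel) = ennreal mp"
    and "0 < mp" "0 < \<delta>"
  shows "\<forall>\<^sub>F x in at_top. ennreal ((2 * mp - \<delta>) * T x)
    \<le> (\<integral>\<^sup>+z. indicator {0..x} z * (emeasure N {x - z<..} * emeasure N {z<..}) \<partial>lborel)"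
proof -
  interpret N: prob_space N by fact
  note sets_N[measurable_cong]
  define H where "H u = emeasure N {u<..}" for u
  have [measurable]: "H \<in> borel_measurable borel"
    unfolding H_def[abs_def]
    by (auto intro!: N.measurable_emeasure simp: sets_eq_imp_space_eq[OF sets_N])
  have H_mono: "H y \<le> H x" if "x \<le> y" for x y
    unfolding H_def using that by (intro emeasure_mono) auto
  obtain B where B: "0 \<le> B" "ennreal (mp - \<delta> / 2) \<le> (\<integral>\<^sup>+t. indicator {0..B} t * H t \<partial>lborel)"
  proof -
    let ?D = "density lborel H"
    have D: "emeasure ?D S = (\<integral>\<^sup>+t. indicator S t * H t \<partial>lborel)" if "S \<in> sets borel" for S
      using that by (subst emeasure_density) (auto simp: mult.commute)
    have "(\<lambda>n. emeasure ?D {0..real n}) \<longlonglongrightarrow> emeasure ?D (\<Union>n. {0..real n})"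
      by (rule Lim_emeasure_incseq) (auto simp: incseq_def)
    also have "(\<Union>n. {0..real n}) = {0..}"
      by (auto intro: real_arch_simple)
    also have "emeasure ?D {0..} = ennreal mp"
      using mp by (simp add: D H_def)
    finally have "\<forall>\<^sub>F n in sequentially. ennreal (mp - \<delta> / 2) < emeasure ?D {0..real n}"
      by (rule order_tendstoD(1)) (use assms in \<open>simp add: ennreal_less_iff ennreal_lessI\<close>)
    then obtain n where "ennreal (mp - \<delta> / 2) < emeasure ?D {0..real n}"
      by (force simp: eventually_sequentially)
    then show thesis by (intro that[of "real n"]) (auto simp: D)
  qed
  have "\<forall>\<^sub>F x in at_top. 2 * B < x" by (rule eventually_gt_at_top)
  then show ?thesis
  proof eventually_elim
    case (elim x)
    have half: "H x * (\<integral>\<^sup>+t. indicator {0..B} t * H t \<partial>lborel)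
      \<le> (\<integral>\<^sup>+z. indicator {0..B} z * (H (x - z) * H z) \<partial>lborel)"
      by (subst nn_integral_cmult[symmetric])
         (auto intro!: nn_integral_mono mult_right_mono H_mono simp: indicator_def)
    have refl: "(\<integral>\<^sup>+z. indicator {x - B..x} z * (H (x - z) * H z) \<partial>lborel)
      = (\<integral>\<^sup>+z. indicator {0..B} z * (H (x - z) * H z) \<partial>lborel)"
      by (subst nn_integral_reflect[where y = x])
         (auto intro!: nn_integral_cong simp: indicator_def mult_ac)
    have "ennreal ((2 * mp - \<delta>) * T x) = H x * (ennreal 2 * ennreal (mp - \<delta> / 2))"
      using T_pos[of x] by (simp add: H_def T ennreal_mult'[symmetric] ennreal_mult''[symmetric] algebra_simps del: ennreal_numeral)
    also have "\<dots> \<le> H x * (2 * (\<integral>\<^sup>+t. indicator {0..B} t * H t \<partial>lborel))"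
      using B(2) by (auto intro!: mult_left_mono simp del: ennreal_mult_le_mult_iff)
    also have "\<dots> = H x * (\<integral>\<^sup>+t. indicator {0..B} t * H t \<partial>lborel) + H x * (\<integral>\<^sup>+t. indicator {0..B} t * H t \<partial>lborel)"
      by (simp add: mult_2 distrib_left)
    also have "\<dots> \<le> (\<integral>\<^sup>+z. indicator {0..B} z * (H (x - z) * H z) \<partial>lborel)
        + (\<integral>\<^sup>+z. indicator {x - B..x} z * (H (x - z) * H z) \<partial>lborel)"
      unfolding refl by (intro add_mono half)
    also have "\<dots> = (\<integral>\<^sup>+z. indicator {0..B} z * (H (x - z) * H z) + indicator {x - B..x} z * (H (x - z) * H z) \<partial>lborel)"
      by (rule nn_integral_add[symmetric]) auto
    also have "\<dots> \<le> (\<integral>\<^sup>+z. indicator {0..x} z * (H (x - z) * H z) \<partial>lborel)"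
      using elim B by (intro nn_integral_mono) (auto simp: indicator_def)
    finally show ?case by (simp add: H_def)
  qed
qed

section \<open>The smoothing function and the law of the walk\<close>

text \<open>Bridge from the nonnegative integrals of the estimates to the gauge integrals in
  \<open>class_S_star\<close> and in the hypothesis on \<open>g\<close>.\<close>

lemma has_integral_of_nn_integral:
  fixes f :: "real \<Rightarrow> real"
  assumes [measurable]: "f \<in> borel_measurable borel" "S \<in> sets borel"
    and "\<And>x. 0 \<le> f x" "0 \<le> r"
    and "(\<integral>\<^sup>+x. indicator S x * ennreal (f x) \<partial>lborel) = ennreal r"
  shows "(f has_integral r) S"
proof -
  have "((\<lambda>x. if x \<in> S then f x else 0) has_integral r) UNIV"
  proof (rule nn_integral_has_integral)
    show "(\<integral>\<^sup>+x. ennreal (if x \<in> S then f x else 0) \<partial>lborel) = ennreal r"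
      unfolding assms(5)[symmetric] by (rule nn_integral_cong) (auto simp: indicator_def)
  qed (use assms in auto)
  then show ?thesis by (simp add: has_integral_restrict_UNIV)
qed

text \<open>Off a null set \<open>g\<close> agrees with \<phi>, and a gauge integral ignores
  negligible sets, so a possibly non-Borel \<open>g\<close> is integrated through \<phi>. The point
  0 joins the exceptional set because the sandwich bounds \<open>g\<close> only for
  \<open>t > 0\<close>.\<close>

lemma sandwich_has_integral:
  fixes g :: "real \<Rightarrow> real" and \<phi> \<psi> :: "real \<Rightarrow> ennreal"
  assumes [measurable]: "\<phi> \<in> borel_measurable borel" "\<psi> \<in> borel_measurable borel"
    and g0: "\<And>t. 0 \<le> t \<Longrightarrow> 0 \<le> g t"
    and z: "\<And>t. t \<le> 0 \<Longrightarrow> \<phi> t = 0"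
    and lo: "\<And>t. 0 < t \<Longrightarrow> \<phi> t \<le> ennreal (g t)" and hi: "\<And>t. 0 < t \<Longrightarrow> ennreal (g t) \<le> \<psi> t"
    and ae: "AE t in lborel. \<phi> t = \<psi> t" and fin: "(\<integral>\<^sup>+t. \<phi> t \<partial>lborel) < \<infinity>"
  shows "(g has_integral enn2real (\<integral>\<^sup>+t. \<phi> t \<partial>lborel)) {0..}"
proof (rule has_integral_spike[where f = "\<lambda>t. enn2real (\<phi> t)" and S = "insert 0 {t. \<phi> t \<noteq> \<psi> t}"])
  have fin_\<phi>: "\<phi> t < \<infinity>" for t
    using lo[of t] z[of t] by (cases "0 < t") (auto intro: le_less_trans)
  have "{t. \<phi> t \<noteq> \<psi> t} \<in> null_sets lborel"
    using ae by (auto simp: AE_iff_null)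
  then have "negligible {t. \<phi> t \<noteq> \<psi> t}"
    by (simp add: negligible_iff_null_sets null_sets_completionI)
  then show "negligible (insert 0 {t. \<phi> t \<noteq> \<psi> t})" by simp
  show "g t = enn2real (\<phi> t)" if "t \<in> {0..} - insert 0 {t. \<phi> t \<noteq> \<psi> t}" for t
  proof -
    have "0 < t" "\<phi> t = \<psi> t" using that by auto
    then have "\<phi> t = ennreal (g t)" using lo[of t] hi[of t] by simp
    then show ?thesis using g0[of t] \<open>0 < t\<close> by simp
  qed
  show "((\<lambda>t. enn2real (\<phi> t)) has_integral enn2real (\<integral>\<^sup>+t. \<phi> t \<partial>lborel)) {0..}"
  proof (rule has_integral_of_nn_integral)
    have "(\<integral>\<^sup>+t. indicator {0..} t * ennreal (enn2real (\<phi> t)) \<partial>lborel) = (\<integral>\<^sup>+t. \<phi> t \<partial>lborel)"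
      using z fin_\<phi> by (intro nn_integral_cong) (auto simp: indicator_def)
    then show "(\<integral>\<^sup>+t. indicator {0..} t * ennreal (enn2real (\<phi> t)) \<partial>lborel)
        = ennreal (enn2real (\<integral>\<^sup>+t. \<phi> t \<partial>lborel))"
      using fin by simp
  qed auto
qed

text \<open>Let \<open>D\<close> be the null set where the functions differ. By Tonelli the
  \<pi>-mass of the translate \<open>x + D\<close>, integrated over \<open>x\<close>, equals the
  Lebesgue measure of \<open>D\<close>, namely 0; so almost every translate is \<pi>-null, even if
  \<pi> has atoms.\<close>

lemma AE_shifted_integrals_eq:
  fixes \<pi> :: "real measure" and \<phi> \<psi> :: "real \<Rightarrow> ennreal"
  assumes "prob_space \<pi>" and sets_\<pi>: "sets \<pi> = sets borel"
    and [measurable]: "\<phi> \<in> borel_measurable borel" "\<psi> \<in> borel_measurable borel"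
    and ae: "AE t in lborel. \<phi> t = \<psi> t"
  shows "AE x in lborel. (\<integral>\<^sup>+y. \<phi> (y - x) \<partial>\<pi>) = (\<integral>\<^sup>+y. \<psi> (y - x) \<partial>\<pi>)"
proof -
  interpret \<pi>: prob_space \<pi> by fact
  interpret L\<pi>: pair_sigma_finite lborel \<pi> ..
  note sets_\<pi>[measurable_cong]
  define D :: "real set" where "D = {t. \<phi> t \<noteq> \<psi> t}"
  have [measurable]: "D \<in> sets borel" unfolding D_def by measurable
  have "(\<integral>\<^sup>+x. \<integral>\<^sup>+y. indicator D (y - x) \<partial>\<pi> \<partial>lborel) = (\<integral>\<^sup>+y. \<integral>\<^sup>+x. indicator D (y - x) \<partial>lborel \<partial>\<pi>)"
    by (subst L\<pi>.Fubini') auto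
  also have "\<dots> = (\<integral>\<^sup>+y. \<integral>\<^sup>+t. indicator D t \<partial>lborel \<partial>\<pi>)"
    by (intro nn_integral_cong nn_integral_reflect[symmetric]) measurable
  also have "(\<integral>\<^sup>+t. indicator D t \<partial>lborel) = 0"
    using ae by (subst nn_integral_0_iff_AE) (auto simp: D_def)
  finally have "(\<integral>\<^sup>+x. \<integral>\<^sup>+y. indicator D (y - x) \<partial>\<pi> \<partial>lborel) = 0"
    by simp
  then have "AE x in lborel. (\<integral>\<^sup>+y. indicator D (y - x) \<partial>\<pi>) = 0"
    by (subst (asm) nn_integral_0_iff_AE) auto
  then show ?thesis
  proof eventually_elim
    case (elim x)
    then have "AE y in \<pi>. indicator D (y - x) = (0 :: ennreal)"
      by (subst (asm) nn_integral_0_iff_AE) auto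
    then have "AE y in \<pi>. \<phi> (y - x) = \<psi> (y - x)"
      by eventually_elim (auto simp: D_def indicator_def split: if_splits)
    then show ?case by (rule nn_integral_cong_AE)
  qed
qed

section \<open>Transfer to the sequence space and to the class S*\<close>

lemma (in prob_space) distr_sequence_iid:
  assumes ind: "indep_vars (\<lambda>_. borel) X (UNIV :: nat set)"
    and iid: "\<And>n. distr M borel (X n) = distr M borel (X 0)"
  shows "distr M (\<Pi>\<^sub>M i\<in>UNIV. borel) (\<lambda>\<omega> i. X i \<omega>) = (\<Pi>\<^sub>M i\<in>UNIV. distr M borel (X 0))"
proof -
  have "random_variable borel (X i)" for i using ind by (auto simp: indep_vars_def)
  then have "distr M (\<Pi>\<^sub>M i\<in>UNIV. borel) (\<lambda>\<omega>. \<lambda>i\<in>UNIV. X i \<omega>) = (\<Pi>\<^sub>M i\<in>UNIV. distr M borel (X i))"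
    using ind by (subst (asm) indep_vars_iff_distr_eq_PiM') auto
  also have "\<dots> = (\<Pi>\<^sub>M i\<in>UNIV. distr M borel (X 0))"
    by (rule PiM_cong[OF refl iid])
  finally show ?thesis by (simp only: restrict_UNIV)
qed


text \<open>The two bounds squeeze the quotient of convolution and tail to \<open>2 * mp\<close>,
  and \<open>mp\<close> is the integral of the tail over the half-line.\<close>

lemma class_S_starI:
  fixes N :: "real measure" and F :: "real \<Rightarrow> real" and mp :: real
  assumes "prob_space N" and sets_N: "sets N = sets borel"
    and T: "\<And>x. emeasure N {x<..} = ennreal (1 - F x)" and T_pos: "\<And>x. 0 < 1 - F x"
    and mp: "(\<integral>\<^sup>+t. indicator {0..} t * emeasure N {t<..} \<partial>lborel) = ennreal mp" "0 < mp"
    and upper: "\<And>\<delta>. 0 < \<delta> \<Longrightarrow> \<forall>\<^sub>F x in at_top.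
      (\<integral>\<^sup>+z. indicator {0..x} z * (emeasure N {x - z<..} * emeasure N {z<..}) \<partial>lborel)
        \<le> ennreal ((2 * mp + \<delta>) * (1 - F x))"
    and lower: "\<And>\<delta>. 0 < \<delta> \<Longrightarrow> \<forall>\<^sub>F x in at_top. ennreal ((2 * mp - \<delta>) * (1 - F x))
        \<le> (\<integral>\<^sup>+z. indicator {0..x} z * (emeasure N {x - z<..} * emeasure N {z<..}) \<partial>lborel)"
  shows "F \<in> class_S_star"
proof -
  interpret N: prob_space N by fact
  note sets_N[measurable_cong]
  define T where "T x = 1 - F x" for x
  have T': "emeasure N {x<..} = ennreal (T x)" for x by (simp add: T T_def)
  have Tp: "0 < T x" for x using T_pos by (simp add: T_def)
  define C where "C x = (\<integral>\<^sup>+z. indicator {0..x} z * (emeasure N {x - z<..} * emeasure N {z<..}) \<partial>lborel)" for x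
  have "(\<lambda>x. emeasure N {x<..}) \<in> borel_measurable borel"
    by (auto intro!: N.measurable_emeasure simp: sets_eq_imp_space_eq[OF sets_N])
  then have "(\<lambda>x. enn2real (emeasure N {x<..})) \<in> borel_measurable borel" by measurable
  then have [measurable]: "T \<in> borel_measurable borel"
    using Tp by (simp add: T' less_imp_le)
  have int_T: "(T has_integral mp) {0..}"
    using mp Tp by (intro has_integral_of_nn_integral) (auto simp: T' less_imp_le)
  have le_1: "emeasure N B \<le> 1" for B using N.emeasure_le_1 .
  \<comment> \<open>Both tails are at most 1 and the range is bounded, so \<open>enn2real\<close>
    loses nothing on \<open>C x\<close>.\<close>
  have "C x \<le> (\<integral>\<^sup>+z. indicator {0..x} z \<partial>lborel)" for x
    unfolding C_def using mult_mono[OF le_1 le_1] by (intro nn_integral_mono) (auto simp: indicator_def)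
  moreover have "(\<integral>\<^sup>+z. indicator {0..x} z \<partial>lborel) < \<infinity>" for x :: real
    by (simp add: emeasure_lborel_Icc_eq)
  ultimately have C_fin: "C x < \<infinity>" for x by (rule le_less_trans)
  have C_int: "integral {0..x} (\<lambda>y. T (x - y) * T y) = enn2real (C x)" for x
  proof (rule integral_unique, rule has_integral_of_nn_integral)
    have "(\<integral>\<^sup>+z. indicator {0..x} z * ennreal (T (x - z) * T z) \<partial>lborel) = C x"
      unfolding C_def using Tp by (intro nn_integral_cong) (simp add: T' ennreal_mult less_imp_le)
    then show "(\<integral>\<^sup>+z. indicator {0..x} z * ennreal (T (x - z) * T z) \<partial>lborel) = ennreal (enn2real (C x))"
      using C_fin by simp
  qed (use Tp in \<open>auto simp: less_imp_le\<close>)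
  have lim: "((\<lambda>x. enn2real (C x) / T x) \<longlongrightarrow> 2 * mp) at_top"
  proof (rule tendstoI)
    fix d :: real assume "0 < d"
    \<comment> \<open>Half of \<open>d\<close> gives the strict inequality; the cap
      \<open>mp\<close> keeps the lower coefficient \<open>2 * mp - \<delta>\<close>
      positive.\<close>
    define \<delta> where "\<delta> = min (d / 2) mp"
    have \<delta>: "0 < \<delta>" "\<delta> < d" "\<delta> \<le> mp" using \<open>0 < d\<close> mp by (auto simp: \<delta>_def)
    show "\<forall>\<^sub>F x in at_top. dist (enn2real (C x) / T x) (2 * mp) < d"
      using upper[OF \<delta>(1)] lower[OF \<delta>(1)]
    proof eventually_elim
      case (elim x)
      have "enn2real (C x) \<le> (2 * mp + \<delta>) * T x"
        using elim(1) \<delta> mp Tp[of x] by (intro enn2real_leI) (auto simp: C_def T_def)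
      moreover have "(2 * mp - \<delta>) * T x \<le> enn2real (C x)"
        using elim(2) C_fin[of x] \<delta> mp Tp[of x]
        by (cases "C x") (auto simp: C_def[symmetric] T_def[symmetric] ennreal_le_iff)
      ultimately have "enn2real (C x) / T x \<le> 2 * mp + \<delta>" "2 * mp - \<delta> \<le> enn2real (C x) / T x"
        using Tp[of x] by (auto simp: field_simps)
      then show ?case using \<delta> by (auto simp: dist_real_def abs_less_iff)
    qed
  qed
  have "(\<lambda>x. enn2real (C x)) \<sim>[at_top] (\<lambda>x. 2 * mp * T x)"
  proof (rule asymp_equivI')
    have "((\<lambda>x. enn2real (C x) / T x / (2 * mp)) \<longlongrightarrow> 2 * mp / (2 * mp)) at_top"
      using mp by (intro tendsto_divide lim tendsto_const) auto
    then show "((\<lambda>x. enn2real (C x) / (2 * mp * T x)) \<longlongrightarrow> 1) at_top"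
      using mp by (simp add: mult.commute)
  qed
  then show ?thesis
    using int_T C_int T_pos by (auto simp: class_S_star_def T_def[abs_def] integral_unique dest: has_integral_integrable)
qed

text \<open>The path map pushes the probability space to the product space, and
  \<open>walk_sup\<close> factors through it, so the balance carries over.\<close>

lemma (in prob_space) walk_sup_balance_iid:
  assumes ind: "indep_vars (\<lambda>_. borel) X UNIV"
    and iid: "\<And>n. distr M borel (X n) = distr M borel (X 0)"
    and fin: "AE \<omega> in M. walk_esup (\<lambda>i. X i \<omega>) < \<infinity>"
  defines "N \<equiv> distr M borel (X 0)"
  defines "\<pi> \<equiv> distr M borel (walk_sup X)"
  assumes x: "0 \<le> x"
  shows "(\<integral>\<^sup>+y. indicator {..x} y * emeasure N {x - y<..} \<partial>\<pi>) =
    (\<integral>\<^sup>+y. indicator {x<..} y * emeasure N {..x - y} \<partial>\<pi>)"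
proof -
  have rv[measurable]: "random_variable borel (X i)" for i using ind by (auto simp: indep_vars_def)
  let ?S = "\<Pi>\<^sub>M i\<in>(UNIV::nat set). N"
  have S: "distr M (\<Pi>\<^sub>M i\<in>UNIV. borel) (\<lambda>\<omega> i. X i \<omega>) = ?S"
    unfolding N_def by (rule distr_sequence_iid[OF ind iid])
  have meas[measurable]: "(\<lambda>\<omega> i. X i \<omega>) \<in> M \<rightarrow>\<^sub>M (\<Pi>\<^sub>M i\<in>(UNIV::nat set). borel)"
    by (rule measurable_PiM_single') auto
  have "\<pi> = distr ?S borel (\<lambda>\<omega>. real_of_ereal (walk_esup \<omega>))"
    unfolding \<pi>_def S[symmetric] by (subst distr_distr) (auto simp: comp_def walk_sup_eq_esup[abs_def])
  moreover have "AE \<omega> in ?S. walk_esup \<omega> < \<infinity>"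
    unfolding S[symmetric] using fin by (subst AE_distr_iff) auto
  moreover have "prob_space N" unfolding N_def by (rule prob_space_distr) simp
  ultimately show ?thesis
    using walk_sup_balance[of N x] x by (simp add: N_def)
qed

section \<open>From the hypothesis on \<open>g\<close> to the two convolution bounds\<close>

theorem theorem2:
  fixes P :: "'a measure" and X :: "nat \<Rightarrow> 'a \<Rightarrow> real"
    and F :: "real \<Rightarrow> real" and m :: real and g :: "real \<Rightarrow> real"
  assumes "prob_space P"
    and "prob_space.indep_vars P (\<lambda>_. borel) X UNIV"
    and "\<And>n. distr P borel (X n) = distr P borel (X 0)"
    and "\<And>x. F x = measure P {\<omega> \<in> space P. X 0 \<omega> \<le> x}"
    and "integrable P (X 0)"
    and "m > 0"
    and "(\<integral>\<omega>. X 0 \<omega> \<partial>P) = - m"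
    and "\<And>x. 1 - F x > 0"
    and "\<And>c. c > 0 \<Longrightarrow> ((\<lambda>x. (1 - F (x - c)) / (1 - F x)) \<longlongrightarrow> 1) at_top"
    and "g \<in> class_G_star"
    and "((\<lambda>x. enn2real (\<integral>\<^sup>+ y\<in>{x<..}. ennreal (g (y - x)) \<partial>(distr P borel (walk_sup X)))
                 / (1 - F x))
          \<longlongrightarrow> integral {0..} g / m) at_top"
  shows "F \<in> class_S_star"
proof -
  interpret prob_space P by fact
  note ind = assms(2) and iid = assms(3) and T_pos = assms(8) and lim = assms(11)
  have rv[measurable]: "random_variable borel (X i)" for i using ind by (auto simp: indep_vars_def)
  define N where "N = distr P borel (X 0)"
  define \<pi> where "\<pi> = distr P borel (walk_sup X)"
  have walk_meas[measurable]: "random_variable borel (walk_sup X)"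
    unfolding walk_sup_def[abs_def] by measurable
  interpret N: prob_space N unfolding N_def by (rule prob_space_distr) simp
  interpret \<pi>: prob_space \<pi> unfolding \<pi>_def by (rule prob_space_distr) simp
  have sets_N: "sets N = sets borel" and sets_\<pi>: "sets \<pi> = sets borel"
    by (simp_all add: N_def \<pi>_def)
  have T: "emeasure N {x<..} = ennreal (1 - F x)" for x
  proof -
    have "emeasure N {x<..} = emeasure P (space P - {\<omega> \<in> space P. X 0 \<omega> \<le> x})"
      unfolding N_def by (subst emeasure_distr) (auto intro!: arg_cong[where f = "emeasure P"])
    also have "\<dots> = ennreal (1 - F x)"
      by (subst emeasure_eq_measure, subst prob_compl) (auto simp: assms(4))
    finally show ?thesis .
  qed
  obtain a b c where abc: "0 \<le> a" "a < b" "0 < c" "\<And>t. t \<in> {a..b} \<Longrightarrow> c \<le> g t"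
    using assms(10) by (auto simp: class_G_star_def)
  have "g \<in> class_G" using assms(10) by (simp add: class_G_star_def)
  then have g0: "0 \<le> g t" if "0 \<le> t" for t using that by (simp add: class_G_def)
  obtain \<phi> \<psi> :: "real \<Rightarrow> ennreal"
    where [measurable]: "\<phi> \<in> borel_measurable borel" "\<psi> \<in> borel_measurable borel"
    and z: "\<And>t. t \<le> 0 \<Longrightarrow> \<phi> t = 0" "\<And>t. t \<le> 0 \<Longrightarrow> \<psi> t = 0"
    and lo: "\<And>t. 0 < t \<Longrightarrow> \<phi> t \<le> ennreal (g t)" and hi: "\<And>t. 0 < t \<Longrightarrow> ennreal (g t) \<le> \<psi> t"
    and ae: "AE t in lborel. \<phi> t = \<psi> t" and fin_\<phi>: "(\<integral>\<^sup>+t. \<phi> t \<partial>lborel) < \<infinity>"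
    using dri_borel_sandwich[OF \<open>g \<in> class_G\<close>] by blast
  define I where "I = integral {0..} g"
  have I_eq: "I = enn2real (\<integral>\<^sup>+t. \<phi> t \<partial>lborel)"
    unfolding I_def
    by (rule integral_unique, rule sandwich_has_integral[OF _ _ g0 z(1) lo hi ae fin_\<phi>]) auto
  have int_\<phi>: "(\<integral>\<^sup>+t. \<phi> t \<partial>lborel) = ennreal I"
    using fin_\<phi> by (simp add: I_eq)
  \<comment> \<open>The interval on which \<open>g \<ge> c\<close> makes \<open>I\<close> positive.
    It is taken left-open because the bound by \<psi> holds only for \<open>t > 0\<close> and
    \<open>a\<close> may be 0.\<close>
  have "ennreal (c * (b - a)) = (\<integral>\<^sup>+t. ennreal c * indicator {a<..b} t \<partial>lborel)"
    using abc by (subst nn_integral_cmult_indicator) (auto simp: ennreal_mult)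
  also have "\<dots> \<le> (\<integral>\<^sup>+t. \<psi> t \<partial>lborel)"
  proof (rule nn_integral_mono)
    fix t
    show "ennreal c * indicator {a<..b} t \<le> \<psi> t"
      using abc(4)[of t] hi[of t] abc(1) order_trans[OF ennreal_leI[of c "g t"]] by (auto simp: indicator_def)
  qed
  also have "\<dots> = ennreal I"
    unfolding int_\<phi>[symmetric] using ae by (intro nn_integral_cong_AE) auto
  finally have I_pos: "0 < I"
    using abc by (cases "0 < I") (auto simp: ennreal_neg mult_le_0_iff)
  define G where "G x = (\<integral>\<^sup>+ y\<in>{x<..}. ennreal (g (y - x)) \<partial>\<pi>)" for x
  have limG: "((\<lambda>x. enn2real (G x) / (1 - F x)) \<longlongrightarrow> I / m) at_top"
    using lim by (simp add: G_def \<pi>_def I_def)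
  have Im: "0 < I / m" using I_pos assms(6) by simp
  have walk_nonneg: "0 \<le> walk_sup X \<omega>" for \<omega>
    by (simp add: walk_sup_eq_esup real_of_ereal_pos walk_esup_nonneg)
  have fin: "AE \<omega> in P. walk_esup (\<lambda>i. X i \<omega>) < \<infinity>"
  proof -
    have meas: "(\<lambda>\<omega>. walk_esup (\<lambda>i. X i \<omega>)) \<in> borel_measurable P"
      unfolding walk_esup_def by measurable
    \<comment> \<open>An infinite supremum is turned into \<open>0\<close> by \<^const>\<open>real_of_ereal\<close>; were it almost sure,
      \<open>G\<close> would vanish on \<open>[0, \<infinity>)\<close>.\<close>
    have "prob {\<omega> \<in> space P. walk_esup (\<lambda>i. X i \<omega>) = \<infinity>} \<noteq> 1"
    proof
      assume "prob {\<omega> \<in> space P. walk_esup (\<lambda>i. X i \<omega>) = \<infinity>} = 1"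
      then have "AE \<omega> in P. walk_esup (\<lambda>i. X i \<omega>) = \<infinity>"
        using meas by (subst (asm) prob_Collect_eq_1) auto
      then have "AE \<omega> in P. walk_sup X \<omega> = 0"
        by eventually_elim (simp add: walk_sup_eq_esup)
      then have "AE y in \<pi>. y = 0"
        unfolding \<pi>_def by (subst AE_distr_iff) auto
      then have G0: "G x = 0" if "0 \<le> x" for x
      proof -
        have "AE y in \<pi>. ennreal (g (y - x)) * indicator {x<..} y = 0"
          using \<open>AE y in \<pi>. y = 0\<close> by eventually_elim (use that in auto)
        from nn_integral_cong_AE[OF this] show ?thesis by (simp add: G_def)
      qed
      have "\<forall>\<^sub>F x in at_top. 0 < enn2real (G x) / (1 - F x)"
        using limG Im by (rule order_tendstoD(1))
      moreover have "\<forall>\<^sub>F x in at_top. (0::real) \<le> x" by (rule eventually_ge_at_top)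
      ultimately have "\<forall>\<^sub>F x::real in at_top. False"
        by eventually_elim (simp add: G0)
      then show False by simp
    qed
    then have "prob {\<omega> \<in> space P. walk_esup (\<lambda>i. X i \<omega>) = \<infinity>} = 0"
      using prob_walk_esup_infinite[OF ind] by simp
    then have "AE \<omega> in P. walk_esup (\<lambda>i. X i \<omega>) \<noteq> \<infinity>"
      using meas by (subst (asm) prob_Collect_eq_0) auto
    then show ?thesis by eventually_elim simp
  qed
  have balance: "(\<integral>\<^sup>+y. indicator {..x} y * emeasure N {x - y<..} \<partial>\<pi>) \<le>
    (\<integral>\<^sup>+y. indicator {x<..} y * emeasure N {..x - y} \<partial>\<pi>)" if "0 \<le> x" for x
    unfolding N_def \<pi>_def using walk_sup_balance_iid[OF ind iid fin that] by simp
  have "emeasure \<pi> {0..} = emeasure P (space P)"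
    unfolding \<pi>_def using walk_nonneg
    by (subst emeasure_distr) (auto intro!: arg_cong[where f = "emeasure P"])
  then have \<pi>_nonneg: "emeasure \<pi> {0..} = 1" by (simp add: emeasure_space_1)
  \<comment> \<open>Transfers the limit from \<open>g\<close> to \<phi>, at the price of an
    exceptional null set of levels.\<close>
  have hyp: "\<exists>x0. AE x in lborel. x0 \<le> x \<longrightarrow>
      ennreal ((1 - e) * (I / m) * (1 - F x)) \<le> (\<integral>\<^sup>+y. \<phi> (y - x) \<partial>\<pi>) \<and>
      (\<integral>\<^sup>+y. \<phi> (y - x) \<partial>\<pi>) \<le> ennreal ((1 + e) * (I / m) * (1 - F x))" if "0 < e" for e
  proof -
    \<comment> \<open>Positivity excludes \<open>G x = \<infinity>\<close>, which
      \<open>enn2real\<close> would send to 0.\<close>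
    have "\<forall>\<^sub>F x in at_top. 0 < enn2real (G x) / (1 - F x)"
      using limG Im by (rule order_tendstoD(1))
    moreover have "\<forall>\<^sub>F x in at_top. (1 - e) * (I / m) < enn2real (G x) / (1 - F x)"
      using limG by (rule order_tendstoD(1)) (use that Im mult_strict_right_mono[of "1 - e" 1 "I / m"] in simp)
    moreover have "\<forall>\<^sub>F x in at_top. enn2real (G x) / (1 - F x) < (1 + e) * (I / m)"
      using limG by (rule order_tendstoD(2)) (use that Im mult_strict_right_mono[of 1 "1 + e" "I / m"] in simp)
    ultimately have "\<forall>\<^sub>F x in at_top. ennreal ((1 - e) * (I / m) * (1 - F x)) \<le> G x \<and>
        G x \<le> ennreal ((1 + e) * (I / m) * (1 - F x))"
    proof eventually_elim
      case (elim x)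
      have T1: "0 < 1 - F x" by (rule T_pos)
      with elim(1) have "0 < enn2real (G x)" by (simp add: zero_less_divide_iff)
      then have Gx: "G x = ennreal (enn2real (G x))"
        by (cases "G x") auto
      have "(1 - e) * (I / m) * (1 - F x) \<le> enn2real (G x)"
        using elim(2) T1 by (simp only: pos_less_divide_eq less_imp_le)
      moreover have "enn2real (G x) \<le> (1 + e) * (I / m) * (1 - F x)"
        using elim(3) T1 by (simp only: pos_divide_less_eq less_imp_le)
      ultimately show ?case
        by (subst (1 2) Gx) (auto intro: ennreal_leI)
    qed
    then obtain x0 where x0: "\<And>x. x0 \<le> x \<Longrightarrow> ennreal ((1 - e) * (I / m) * (1 - F x)) \<le> G x \<and>
        G x \<le> ennreal ((1 + e) * (I / m) * (1 - F x))"
      by (auto simp: eventually_at_top_linorder)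
    \<comment> \<open>Monotonicity of the nonnegative integral holds for arbitrary functions, so
      \<open>G x\<close> is sandwiched even if \<open>g\<close> is not measurable; where the outer
      integrals agree, it equals both.\<close>
    have lower: "(\<integral>\<^sup>+y. \<phi> (y - x) \<partial>\<pi>) \<le> G x" and upper: "G x \<le> (\<integral>\<^sup>+y. \<psi> (y - x) \<partial>\<pi>)" for x
      unfolding G_def using lo[of "_ - x"] hi[of "_ - x"] z
      by (auto intro!: nn_integral_mono simp: indicator_def)
    show ?thesis
    proof (rule exI[of _ x0])
      have "AE x in lborel. (\<integral>\<^sup>+y. \<phi> (y - x) \<partial>\<pi>) = (\<integral>\<^sup>+y. \<psi> (y - x) \<partial>\<pi>)"
        by (rule AE_shifted_integrals_eq[OF \<pi>.prob_space_axioms sets_\<pi> _ _ ae]) auto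
      then show "AE x in lborel. x0 \<le> x \<longrightarrow>
          ennreal ((1 - e) * (I / m) * (1 - F x)) \<le> (\<integral>\<^sup>+y. \<phi> (y - x) \<partial>\<pi>) \<and>
          (\<integral>\<^sup>+y. \<phi> (y - x) \<partial>\<pi>) \<le> ennreal ((1 + e) * (I / m) * (1 - F x))"
      proof eventually_elim
        case (elim x)
        with lower[of x] upper[of x] have "(\<integral>\<^sup>+y. \<phi> (y - x) \<partial>\<pi>) = G x" by simp
        with x0[of x] show ?case by simp
      qed
    qed
  qed
  define mp where "mp = (\<integral>\<omega>. max 0 (X 0 \<omega>) \<partial>P)"
  have int_max: "integrable P (\<lambda>\<omega>. max 0 (X 0 \<omega>))" "integrable P (\<lambda>\<omega>. max 0 (- X 0 \<omega>))"
    using assms(5) by auto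
  have mp: "(\<integral>\<^sup>+t. indicator {0..} t * emeasure N {t<..} \<partial>lborel) = ennreal mp"
  proof -
    have "(\<integral>\<^sup>+s. ennreal s \<partial>N) = (\<integral>\<^sup>+\<omega>. ennreal (max 0 (X 0 \<omega>)) \<partial>P)"
      unfolding N_def by (subst nn_integral_distr) (auto simp: ennreal_max_0)
    also have "\<dots> = ennreal mp"
      unfolding mp_def using int_max by (intro nn_integral_eq_integral) auto
    finally show ?thesis by (simp add: nn_integral_tail[OF N.prob_space_axioms sets_N])
  qed
  have mm: "(\<integral>\<^sup>+t. indicator {0<..} t * emeasure N {..- t} \<partial>lborel) = ennreal (mp + m)"
  proof -
    have "(\<integral>\<^sup>+s. ennreal (- s) \<partial>N) = (\<integral>\<^sup>+\<omega>. ennreal (max 0 (- X 0 \<omega>)) \<partial>P)"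
      unfolding N_def by (subst nn_integral_distr) (auto simp: ennreal_max_0)
    also have "\<dots> = ennreal (\<integral>\<omega>. max 0 (- X 0 \<omega>) \<partial>P)"
      using int_max by (intro nn_integral_eq_integral) auto
    \<comment> \<open>The negative part is the positive part minus the variable, whose mean is
      \<open>- m\<close>.\<close>
    also have "(\<integral>\<omega>. max 0 (- X 0 \<omega>) \<partial>P) = (\<integral>\<omega>. max 0 (X 0 \<omega>) - X 0 \<omega> \<partial>P)"
      by (rule Bochner_Integration.integral_cong) auto
    also have "\<dots> = mp + m"
      using int_max assms(5,7) by (simp add: mp_def)
    finally show ?thesis by (simp add: nn_integral_tail[OF N.prob_space_axioms sets_N] del: ennreal_plus)
  qed
  \<comment> \<open>On \<open>[0, 1]\<close> the tail is at least its positive value at 1.\<close>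
  have mp_pos: "0 < mp"
  proof -
    have "ennreal (1 - F 1) = (\<integral>\<^sup>+t. ennreal (1 - F 1) * indicator {0..1::real} t \<partial>lborel)"
      by (subst nn_integral_cmult_indicator) auto
    also have "\<dots> \<le> ennreal mp"
      unfolding mp[symmetric] T[symmetric]
      by (intro nn_integral_mono) (auto simp: indicator_def sets_N intro!: emeasure_mono)
    finally have "ennreal (1 - F 1) \<le> ennreal mp" .
    then show ?thesis using T_pos[of 1] by (cases "0 < mp") (auto simp: ennreal_neg)
  qed
  show ?thesis
  proof (rule class_S_starI[OF N.prob_space_axioms sets_N T T_pos mp mp_pos])
    fix \<delta> :: real assume "0 < \<delta>"
    show "\<forall>\<^sub>F x in at_top. (\<integral>\<^sup>+z. indicator {0..x} z * (emeasure N {x - z<..} * emeasure N {z<..}) \<partial>lborel)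
        \<le> ennreal ((2 * mp + \<delta>) * (1 - F x))"
      by (rule convolution_upper_bound[OF N.prob_space_axioms sets_N \<pi>.prob_space_axioms sets_\<pi> \<pi>_nonneg
            balance _ z(1) int_\<phi> T T_pos assms(9) mp mm assms(6) less_imp_le[OF mp_pos] I_pos hyp \<open>0 < \<delta>\<close>]) auto
    show "\<forall>\<^sub>F x in at_top. ennreal ((2 * mp - \<delta>) * (1 - F x))
        \<le> (\<integral>\<^sup>+z. indicator {0..x} z * (emeasure N {x - z<..} * emeasure N {z<..}) \<partial>lborel)"
      by (rule convolution_lower_bound[OF N.prob_space_axioms sets_N T T_pos mp mp_pos \<open>0 < \<delta>\<close>])
  qed
qed

end
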